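(* Let $f,g\in K[X]^{S_n}$ be symmetric Laurent polynomials. Then $$(f,g)_{q,qt}=\frac{W_0(qt)}{W_0(t^{-1})}\,(A_\rho f,A_\rho g)_{q,t},$$ where $A_\rho=A_\rho(t)=\prod_{1\le i<j\le n}(x_j-tx_i)$ and $W_0(t)=\sum_{w\in S_n}t^{\ell(w)}$.
   Context: Let $n\ge1$, let $q,t^{1/2}$ be independent indeterminates over $\mathbb{C}$, $t=(t^{1/2})^2$, $K=\mathbb{C}(q,t^{1/2})$, $K[X]=K[x_1^{\pm1},\ldots,x_n^{\pm1}]$; $S_n$ acts by permuting variables, and $\ell$ is the length function on $S_n$. The bar involution on $K[X]$ is the $\mathbb{C}$-algebra automorphism $x_i\mapsto x_i^{-1}$, $q\mapsto q^{-1}$, $t^{1/2}\mapsto t^{-1/2}$. With $(z;q)_\infty=\prod_{r\ge0}(1-q^rz)$, put $$J_{q,t}=\prod_{1\le i<j\le n}\frac{(x_ix_j^{-1};q)_\infty}{(tx_ix_j^{-1};q)_\infty}\cdot\frac{(qx_i^{-1}x_j;q)_\infty}{(qtx_i^{-1}x_j;q)_\infty},$$ expanded as a formal power series, with coefficients in $\mathbb{Z}[t]$, in $x_ix_{i+1}^{-1}$ ($1\le i\le n-1$) and $qx_1^{-1}x_n$ (so the coefficient of each monomial $x^\mu$ is an element of $\mathbb{Z}[t][[q]]$). The inner product is $(f_1,f_2)_{q,t}=\mathrm{ct}(f_1\overline{f_2}J_{q,t})$, where $\mathrm{ct}$ is the coefficient of $x^0$; it takes values in $\mathbb{C}(t^{1/2})((q))\supset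 K$. The inner product $(f_1,f_2)_{q,qt}=\mathrm{ct}(f_1\overline{f_2}J_{q,qt})$ is obtained by replacing $t$ by $qt$ in $J_{q,t}$ (with the same bar involution, which sends $qt$ to $(qt)^{-1}$). *)

theory Defs
  imports
    "HOL-Analysis.Infinite_Products"
    "HOL-Library.Poly_Mapping"
    "HOL-Library.Groups_Big_Fun"
    "HOL-Computational_Algebra.Computational_Algebra"
    "HOL-Combinatorics.Permutations"
begin

section \<open>The coefficient field\<close>

text \<open>
  The field $K = \mathbb{C}(q, t^{1/2})$ is built as $\mathbb{C}(t^{1/2})(q)$, so that it sits
  inside the field of Laurent series $\mathbb{C}(t^{1/2})((q))$.
\<close>

type_synonym ratfun_s = "complex poly fract"
type_synonym ratfun_qs = "ratfun_s poly fract"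

definition fract_const :: "'a::idom \<Rightarrow> 'a poly fract"
  where "fract_const c = Fraction_Field.Fract [:c:] 1"

definition fract_var :: "'a::idom poly fract"
  where "fract_var = Fraction_Field.Fract [:0, 1:] 1"

definition s_F :: ratfun_s \<comment> \<open>the indeterminate $t^{1/2}$\<close>
  where "s_F = fract_var"

definition t_F :: ratfun_s
  where "t_F = s_F ^ 2"

definition q_K :: ratfun_qs
  where "q_K = fract_var"

definition t_K :: ratfun_qs
  where "t_K = fract_const t_F"

text \<open>
  Extension of an injective ring homomorphism to the field of fractions; the value does not depend
  on the fraction chosen, see \<open>lift_fract_Fract\<close> below.
\<close>

definition lift_fract :: "('a::idom \<Rightarrow> 'b::field) \<Rightarrow> 'a fract \<Rightarrow> 'b"
  where "lift_fract h x = (THE z. \<exists>a b. b \<noteq> 0 \<and> x = Fraction_Field.Fract a b \<and> z = h a / h b)"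

definition bar_F :: "ratfun_s \<Rightarrow> ratfun_s"
  where "bar_F = lift_fract (\<lambda>p. poly (map_poly fract_const p) (inverse s_F))"

definition bar_K :: "ratfun_qs \<Rightarrow> ratfun_qs"
  where "bar_K = lift_fract (\<lambda>p. poly (map_poly (\<lambda>c. fract_const (bar_F c)) p) (inverse q_K))"

definition expand_q :: "ratfun_qs \<Rightarrow> ratfun_s fls"
  where "expand_q = lift_fract (\<lambda>p. fps_to_fls (fps_of_poly p))"


section \<open>Laurent polynomials\<close>

text \<open>
  Exponent vectors $\mu \in \mathbb{Z}^n$ are finitely supported functions supported in
  \<open>{1..n}\<close>; Laurent polynomials are elements of the group ring.
\<close>

type_synonym exponent = "nat \<Rightarrow>\<^sub>0 int"
type_synonym 'a lpoly = "exponent \<Rightarrow>\<^sub>0 'a"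

definition laurent_polys :: "nat \<Rightarrow> 'a::zero lpoly set"
  where "laurent_polys n = {f. \<forall>\<mu>\<in>Poly_Mapping.keys f. Poly_Mapping.keys \<mu> \<subseteq> {1..n}}"

definition var :: "nat \<Rightarrow> 'a::{zero,one} lpoly"
  where "var i = Poly_Mapping.single (Poly_Mapping.single i 1) 1"

definition const :: "'a::zero \<Rightarrow> 'a lpoly"
  where "const c = Poly_Mapping.single 0 c"

text \<open>
  The ring automorphism with $x_i \mapsto x_{w(i)}$: the coefficient of $x^\mu$ in the image is
  the coefficient of $x^{\mu \circ w}$ in the original.
\<close>

definition permute_vars :: "(nat \<Rightarrow> nat) \<Rightarrow> 'a::zero lpoly \<Rightarrow> 'a lpoly"
  where "permute_vars w f = Poly_Mapping.map_key (Poly_Mapping.map_key w) f"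

definition symmetric_laurent_polys :: "nat \<Rightarrow> 'a::zero lpoly set"
  where "symmetric_laurent_polys n =
    {f \<in> laurent_polys n. \<forall>w. w permutes {1..n} \<longrightarrow> permute_vars w f = f}"

definition bar :: "ratfun_qs lpoly \<Rightarrow> ratfun_qs lpoly"
  where "bar f = Poly_Mapping.map bar_K (Poly_Mapping.map_key uminus f)"

definition pairs :: "nat \<Rightarrow> (nat \<times> nat) set"
  where "pairs n = {(i, j). 1 \<le> i \<and> i < j \<and> j \<le> n}"

definition A_rho :: "nat \<Rightarrow> ratfun_qs lpoly"
  where "A_rho n = (\<Prod>(i, j)\<in>pairs n. var j - const t_K * var i)"


section \<open>The Poincare polynomial of the symmetric group\<close>

text \<open>Length with respect to the simple transpositions $(i\; i+1)$, $1 \le i < n$.\<close>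

definition perm_length :: "nat \<Rightarrow> (nat \<Rightarrow> nat) \<Rightarrow> nat"
  where "perm_length n w = (LEAST k. \<exists>is. length is = k \<and> set is \<subseteq> {1..<n} \<and>
    w = foldr (\<lambda>i v. Transposition.transpose i (Suc i) \<circ> v) is id)"

definition W0 :: "nat \<Rightarrow> 'a::comm_semiring_1 \<Rightarrow> 'a"
  where "W0 n a = (\<Sum>w | w permutes {1..n}. a ^ perm_length n w)"


section \<open>The weight function\<close>

text \<open>
  A formal power series in the generators $y_0 = q x_1^{-1} x_n$ and $y_i = x_i x_{i+1}^{-1}$
  ($1 \le i < n$) is represented by its homogeneous components: each generator is multiplied by
  the variable $u$ (\<open>fps_X\<close>), and the coefficient of $u^d$ is the part of the series that is
  homogeneous of degree $d$ in the generators, a Laurent polynomial in the $x_i$ over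
  $\mathbb{C}(t^{1/2})[q]$. Convergence of infinite products is the $u$-adic one.
\<close>

type_synonym graded_series = "ratfun_s poly lpoly fps"

definition gen :: "nat \<Rightarrow> nat \<Rightarrow> graded_series"
  where "gen n i = fps_X * fps_const
    (if i = 0 then Poly_Mapping.single (Poly_Mapping.single n 1 - Poly_Mapping.single 1 1) [:0, 1:]
     else Poly_Mapping.single (Poly_Mapping.single i 1 - Poly_Mapping.single (Suc i) 1) 1)"

text \<open>
  Here $q = y_0 y_1 \cdots y_{n-1}$ and, for $i < j$, $x_i x_j^{-1} = y_i \cdots y_{j-1}$ and
  $q x_i^{-1} x_j = y_0 \cdots y_{i-1} \cdot y_j \cdots y_{n-1}$.
\<close>

definition q_S :: "nat \<Rightarrow> graded_series"
  where "q_S n = (\<Prod>k\<in>{0..<n}. gen n k)"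

definition t_S :: graded_series
  where "t_S = fps_const (const [:t_F:])"

definition pos_root :: "nat \<Rightarrow> nat \<Rightarrow> nat \<Rightarrow> graded_series"
  where "pos_root n i j = (\<Prod>k\<in>{i..<j}. gen n k)"

definition q_neg_root :: "nat \<Rightarrow> nat \<Rightarrow> nat \<Rightarrow> graded_series"
  where "q_neg_root n i j = (\<Prod>k\<in>{0..<i} \<union> {j..<n}. gen n k)"

definition q_poch :: "nat \<Rightarrow> graded_series \<Rightarrow> graded_series"
  where "q_poch n z = prodinf (\<lambda>r. 1 - q_S n ^ r * z)"

text \<open>
  The multiplicative inverse of a series with constant term 1; the class-based \<open>inverse\<close> on
  \<open>fps\<close> is not available because the coefficients do not form a field.
\<close>

definition inv_series :: "graded_series \<Rightarrow> graded_series"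
  where "inv_series z = fps_right_inverse z 1"

text \<open>The parameter \<open>a\<close> takes the place of $t$; it is instantiated with $t$ and with $qt$.\<close>

definition J_series :: "nat \<Rightarrow> graded_series \<Rightarrow> graded_series"
  where "J_series n a = (\<Prod>(i, j)\<in>pairs n.
     q_poch n (pos_root n i j) * inv_series (q_poch n (a * pos_root n i j)) *
     (q_poch n (q_neg_root n i j) * inv_series (q_poch n (a * q_neg_root n i j))))"

text \<open>
  The coefficient of $x^\mu$, as a power series in $q$, is obtained by setting $u = 1$. The sum over
  the degrees \<open>d\<close> is finite, since the monomial $q^k x^\mu$ determines the exponents of the
  generators, hence \<open>d\<close>.
\<close>

definition J_coeff :: "nat \<Rightarrow> graded_series \<Rightarrow> exponent \<Rightarrow> ratfun_s fps"
  where "J_coeff n a \<mu> =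
    Abs_fps (\<lambda>k. Sum_any (\<lambda>d.
      coeff (Poly_Mapping.lookup (fps_nth (J_series n a) d) \<mu>) k))"


section \<open>The inner products\<close>

text \<open>Coefficient of $x^\nu$ in the product of a Laurent polynomial and a formal series in the $x_i$.\<close>

definition mult_series ::
  "ratfun_qs lpoly \<Rightarrow> (exponent \<Rightarrow> ratfun_s fps) \<Rightarrow> exponent \<Rightarrow> ratfun_s fls"
  where "mult_series h c \<nu> =
    (\<Sum>\<mu>\<in>Poly_Mapping.keys h. expand_q (Poly_Mapping.lookup h \<mu>) * fps_to_fls (c (\<nu> - \<mu>)))"

definition ct :: "(exponent \<Rightarrow> 'a) \<Rightarrow> 'a"
  where "ct c = c 0"

definition inner_prod ::
  "nat \<Rightarrow> graded_series \<Rightarrow> ratfun_qs lpoly \<Rightarrow> ratfun_qs lpoly \<Rightarrow> ratfun_s fls"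
  where "inner_prod n a f g = ct (mult_series (f * bar g) (J_coeff n a))"

definition inner_q_t :: "nat \<Rightarrow> ratfun_qs lpoly \<Rightarrow> ratfun_qs lpoly \<Rightarrow> ratfun_s fls"
  where "inner_q_t n = inner_prod n t_S"

definition inner_q_qt :: "nat \<Rightarrow> ratfun_qs lpoly \<Rightarrow> ratfun_qs lpoly \<Rightarrow> ratfun_s fls"
  where "inner_q_qt n = inner_prod n (q_S n * t_S)"


section \<open>Basic properties\<close>

definition inj_hom :: "('a::comm_ring_1 \<Rightarrow> 'b::comm_ring_1) \<Rightarrow> bool"
  where "inj_hom h \<longleftrightarrow> h 1 = 1 \<and> (\<forall>a b. h (a + b) = h a + h b) \<and> (\<forall>a b. h (a * b) = h a * h b) \<and>
    (\<forall>a. h a = 0 \<longrightarrow> a = 0)"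

lemma inj_homD:
  assumes "inj_hom h"
  shows "h 1 = 1" "h (a + b) = h a + h b" "h (a * b) = h a * h b" "h 0 = 0" "h a = 0 \<longleftrightarrow> a = 0"
proof -
  have "h (0 + 0) = h 0 + h 0" using assms unfolding inj_hom_def by blast
  then show h0: "h 0 = 0" by simp
  show "h 1 = 1" "h (a + b) = h a + h b" "h (a * b) = h a * h b" "h a = 0 \<longleftrightarrow> a = 0"
    using assms h0 unfolding inj_hom_def by auto
qed

lemma lift_fract_Fract:
  fixes h :: "'a::idom \<Rightarrow> 'b::field"
  assumes "inj_hom h" "b \<noteq> 0"
  shows "lift_fract h (Fraction_Field.Fract a b) = h a / h b"
  unfolding lift_fract_def
proof (rule the_equality)
  show "\<exists>c d. d \<noteq> 0 \<and> Fraction_Field.Fract a b = Fraction_Field.Fract c d \<and> h a / h b = h c / h d"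
    using assms by blast
next
  fix z assume "\<exists>c d. d \<noteq> 0 \<and> Fraction_Field.Fract a b = Fraction_Field.Fract c d \<and> z = h c / h d"
  then obtain c d where cd: "d \<noteq> 0" "Fraction_Field.Fract a b = Fraction_Field.Fract c d" "z = h c / h d"
    by blast
  then have "a * d = c * b" using assms(2) by (simp add: eq_fract)
  then have "h a * h d = h c * h b" using inj_homD(3)[OF assms(1)] by metis
  then show "z = h a / h b"
    using cd(1,3) assms(2) inj_homD(5)[OF assms(1)] by (simp add: frac_eq_eq)
qed

lemma inj_hom_lift_fract:
  fixes h :: "'a::idom \<Rightarrow> 'b::field"
  assumes h: "inj_hom h"
  shows "inj_hom (lift_fract h)"
proof -
  note L = lift_fract_Fract[OF h] and H = inj_homD[OF h]
  have 1: "lift_fract h 1 = 1"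
    by (simp add: One_fract_def L H)
  have 2: "lift_fract h (x + y) = lift_fract h x + lift_fract h y" for x y
  proof (cases x, cases y)
    fix a b c d assume "x = Fraction_Field.Fract a b" "b \<noteq> 0" "y = Fraction_Field.Fract c d" "d \<noteq> 0"
    then show ?thesis by (simp add: L H add_frac_eq)
  qed
  have 3: "lift_fract h (x * y) = lift_fract h x * lift_fract h y" for x y
  proof (cases x, cases y)
    fix a b c d assume "x = Fraction_Field.Fract a b" "b \<noteq> 0" "y = Fraction_Field.Fract c d" "d \<noteq> 0"
    then show ?thesis by (simp add: L H)
  qed
  have 4: "x = 0" if "lift_fract h x = 0" for x
  proof (cases x)
    fix a b assume "x = Fraction_Field.Fract a b" "b \<noteq> 0"
    then show ?thesis using that by (simp add: L H eq_fract Zero_fract_def)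
  qed
  show ?thesis unfolding inj_hom_def using 1 2 3 4 by blast
qed

lemma inj_hom_fract_const: "inj_hom (fract_const :: 'a::idom \<Rightarrow> _)"
  unfolding inj_hom_def fract_const_def
  by (auto simp: One_fract_def one_pCons Zero_fract_def eq_fract)

lemma poly_fract_var:
  fixes p :: "'a::idom poly"
  shows "poly (map_poly fract_const p) fract_var = Fraction_Field.Fract p 1"
proof (induction p)
  case (pCons c p)
  have "poly (map_poly fract_const (pCons c p)) fract_var = fract_const c + fract_var * Fraction_Field.Fract p 1"
  proof -
    have 0: "fract_const (0::'a) = 0" by (rule inj_homD(4)[OF inj_hom_fract_const])
    show ?thesis by (simp add: map_poly_pCons[of fract_const, OF 0] pCons.IH)
  qed
  also have "\<dots> = Fraction_Field.Fract (pCons c p) 1"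
    by (simp add: fract_const_def fract_var_def)
  finally show ?case .
qed (simp add: Zero_fract_def)

lemma reflect_poly_map_poly:
  assumes "\<And>a. f a = 0 \<longleftrightarrow> a = 0"
  shows "reflect_poly (map_poly f p) = map_poly f (reflect_poly p)"
proof (rule poly_eqI)
  fix k
  have d: "degree (map_poly f p) = degree p" by (rule degree_map_poly) (simp add: assms)
  have f0: "f 0 = 0" using assms by simp
  show "coeff (reflect_poly (map_poly f p)) k = coeff (map_poly f (reflect_poly p)) k"
    by (simp add: coeff_reflect_poly d coeff_map_poly f0)
qed

lemma inj_hom_invert_var:
  fixes \<sigma> :: "'a::field \<Rightarrow> 'b::field"
  assumes "inj_hom \<sigma>"
  shows "inj_hom (\<lambda>p. poly (map_poly (\<lambda>c. fract_const (\<sigma> c)) p) (inverse fract_var))"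
proof -
  let ?f = "\<lambda>c. fract_const (\<sigma> c)"
  note S = inj_homD[OF assms] and C = inj_homD[OF inj_hom_fract_const]
  have hf: "?f 1 = 1" "?f 0 = 0" "?f (a + b) = ?f a + ?f b" "?f (a * b) = ?f a * ?f b"
    "?f a = 0 \<longleftrightarrow> a = 0" for a b by (simp_all add: S C)
  have v: "fract_var \<noteq> (0 :: 'b poly fract)"
    by (simp add: fract_var_def Zero_fract_def eq_fract)
  have add: "map_poly ?f (p + q) = map_poly ?f p + map_poly ?f q" for p q
    by (rule poly_eqI) (simp add: coeff_map_poly hf)
  have sm: "map_poly ?f (smult c q) = smult (?f c) (map_poly ?f q)" for c q
    by (rule poly_eqI) (simp add: coeff_map_poly hf)
  have mult: "map_poly ?f (p * q) = map_poly ?f p * map_poly ?f q" for p q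
    by (induction p) (simp_all add: map_poly_pCons hf add sm)
  have inj: "p = 0" if "poly (map_poly ?f p) (inverse fract_var) = 0" for p
  proof -
    have "poly (reflect_poly (map_poly ?f p)) fract_var = 0"
      using that v by (simp add: poly_reflect_poly_nz)
    moreover have "reflect_poly (map_poly ?f p) = map_poly fract_const (map_poly \<sigma> (reflect_poly p))"
      by (simp add: reflect_poly_map_poly hf map_poly_map_poly S C o_def)
    ultimately have "Fraction_Field.Fract (map_poly \<sigma> (reflect_poly p)) 1 = 0"
      by (simp add: poly_fract_var)
    then have "map_poly \<sigma> (reflect_poly p) = 0"
      by (simp add: Zero_fract_def eq_fract)
    then have "reflect_poly p = 0"
      by (metis S(4,5) coeff_map_poly coeff_0 poly_eqI)
    then show ?thesis by simp
  qed
  show ?thesis unfolding inj_hom_def using inj by (auto simp: add mult hf map_poly_1')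
qed

lemma inj_hom_bar_F: "inj_hom bar_F"
proof -
  have "inj_hom (\<lambda>x::complex. x)" by (simp add: inj_hom_def)
  from inj_hom_lift_fract[OF inj_hom_invert_var[OF this]]
  show ?thesis by (simp add: bar_F_def s_F_def)
qed

lemma inj_hom_bar_K: "inj_hom bar_K"
  using inj_hom_lift_fract[OF inj_hom_invert_var[OF inj_hom_bar_F]]
  by (simp add: bar_K_def q_K_def)

lemma bar_F_simps: "bar_F (fract_const c) = fract_const c" "bar_F s_F = inverse s_F"
proof -
  have h: "inj_hom (\<lambda>p. poly (map_poly fract_const p) (inverse s_F) :: ratfun_s)"
    using inj_hom_invert_var[of "\<lambda>x::complex. x"] by (simp add: inj_hom_def s_F_def)
  note C = inj_homD[OF inj_hom_fract_const]
  show "bar_F (fract_const c) = fract_const c"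
    unfolding bar_F_def by (subst fract_const_def) (simp add: lift_fract_Fract[OF h] map_poly_pCons C map_poly_1')
  show "bar_F s_F = inverse s_F"
    unfolding bar_F_def by (subst (2) s_F_def, subst fract_var_def) (simp add: lift_fract_Fract[OF h] map_poly_pCons C map_poly_1')
qed

lemma bar_K_simps:
  "bar_K (fract_const c) = fract_const (bar_F c)" "bar_K q_K = inverse q_K"
  "bar_K t_K = inverse t_K"
proof -
  have h: "inj_hom (\<lambda>p. poly (map_poly (\<lambda>c. fract_const (bar_F c)) p) (inverse q_K))"
    using inj_hom_invert_var[OF inj_hom_bar_F] by (simp add: q_K_def)
  note C = inj_homD[OF inj_hom_fract_const] inj_homD[OF inj_hom_bar_F]
  show 1: "bar_K (fract_const c) = fract_const (bar_F c)" for c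
    unfolding bar_K_def by (subst fract_const_def) (simp add: lift_fract_Fract[OF h] map_poly_pCons C map_poly_1')
  show "bar_K q_K = inverse q_K"
    unfolding bar_K_def by (subst (2) q_K_def, subst fract_var_def) (simp add: lift_fract_Fract[OF h] map_poly_pCons C map_poly_1')
  have s: "s_F \<noteq> 0" by (simp add: s_F_def fract_var_def Zero_fract_def eq_fract)
  have "bar_F t_F * t_F = 1" by (simp add: t_F_def power2_eq_square C bar_F_simps) (simp add: s mult_ac)
  then have "bar_K t_K * t_K = 1" unfolding t_K_def 1 by (metis C(1,3))
  then show "bar_K t_K = inverse t_K" by (metis inverse_unique mult.commute)
qed

lemma inj_hom_expand_q: "inj_hom expand_q"
  unfolding expand_q_def
  by (rule inj_hom_lift_fract)
    (auto simp: inj_hom_def fps_of_poly_add fps_of_poly_mult fls_times_fps_to_fls fps_to_fls_eq_0_iff)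

lemma expand_q_simps: "expand_q (fract_const c) = fls_const c" "expand_q q_K = fls_X"
proof -
  have h: "inj_hom (\<lambda>p::ratfun_s poly. fps_to_fls (fps_of_poly p))"
    by (auto simp: inj_hom_def fps_of_poly_add fps_of_poly_mult fls_times_fps_to_fls fps_to_fls_eq_0_iff)
  show "expand_q (fract_const c) = fls_const c" 
    unfolding expand_q_def fract_const_def
    by (simp add: lift_fract_Fract[OF h] fps_of_poly_pCons)
  show "expand_q q_K = fls_X" 
    unfolding expand_q_def q_K_def fract_var_def by (simp add: lift_fract_Fract[OF h])
qed

lemma lookup_permute_vars:
  assumes "w permutes {1..n}"
  shows "Poly_Mapping.lookup (permute_vars w f) \<mu> = Poly_Mapping.lookup f (Poly_Mapping.map_key w \<mu>)"
    "Poly_Mapping.lookup (Poly_Mapping.map_key w \<mu>) k = Poly_Mapping.lookup \<mu> (w k)"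
proof -
  have i: "inj w" using assms by (simp add: permutes_inj)
  show 1: "Poly_Mapping.lookup (Poly_Mapping.map_key w \<mu>) k = Poly_Mapping.lookup \<mu> (w k)" for \<mu> :: exponent and k
    using i by (simp add: map_key.rep_eq)
  have "inj (Poly_Mapping.map_key w :: exponent \<Rightarrow> exponent)"
  proof (rule injI, rule poly_mapping_eqI)
    fix \<mu> \<nu> :: exponent and k assume "Poly_Mapping.map_key w \<mu> = Poly_Mapping.map_key w \<nu>"
    then have "Poly_Mapping.lookup \<mu> (w (inv w k)) = Poly_Mapping.lookup \<nu> (w (inv w k))"
      using 1 by metis
    then show "Poly_Mapping.lookup \<mu> k = Poly_Mapping.lookup \<nu> k"
      using permutes_inverses(1)[OF assms] by simp
  qed
  then show "Poly_Mapping.lookup (permute_vars w f) \<mu> = Poly_Mapping.lookup f (Poly_Mapping.map_key w \<mu>)"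
    by (simp add: permute_vars_def map_key.rep_eq)
qed

lemma permute_vars_var:
  assumes "w permutes {1..n}"
  shows "permute_vars w (var i) = (var (w i) :: 'a::zero_neq_one lpoly)"
proof (rule poly_mapping_eqI)
  fix \<mu> :: exponent
  have "Poly_Mapping.map_key w \<mu> = Poly_Mapping.single i 1 \<longleftrightarrow> \<mu> = Poly_Mapping.single (w i) 1"
  proof
    assume "\<mu> = Poly_Mapping.single (w i) 1"
    then show "Poly_Mapping.map_key w \<mu> = Poly_Mapping.single i 1"
      using map_key_single[OF permutes_inj[OF assms]] by simp
  next
    assume *: "Poly_Mapping.map_key w \<mu> = Poly_Mapping.single i 1"
    show "\<mu> = Poly_Mapping.single (w i) 1"
    proof (rule poly_mapping_eqI)
      fix k
      have "Poly_Mapping.lookup \<mu> k = Poly_Mapping.lookup (Poly_Mapping.map_key w \<mu>) (inv w k)"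
        unfolding lookup_permute_vars(2)[OF assms] permutes_inverses(1)[OF assms] ..
      then show "Poly_Mapping.lookup \<mu> k = Poly_Mapping.lookup (Poly_Mapping.single (w i) 1) k"
        unfolding * using permutes_inverses[OF assms] by (auto simp: lookup_single when_def)
    qed
  qed
  then show "Poly_Mapping.lookup (permute_vars w (var i)) \<mu> = Poly_Mapping.lookup (var (w i) :: 'a lpoly) \<mu>"
    unfolding lookup_permute_vars(1)[OF assms] var_def by (auto simp: lookup_single when_def)
qed

lemma lookup_bar: "Poly_Mapping.lookup (bar f) \<mu> = bar_K (Poly_Mapping.lookup f (- \<mu>))"
  by (simp add: bar_def map.rep_eq map_key.rep_eq when_def inj_homD(4)[OF inj_hom_bar_K])

lemma pos_root_eq:
  assumes "1 \<le> i" "i \<le> j"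
  shows "pos_root n i j = fps_X ^ (j - i) *
    fps_const (Poly_Mapping.single (Poly_Mapping.single i 1 - Poly_Mapping.single j 1) 1)"
  using assms(2)
proof (induction j rule: dec_induct)
  case base show ?case by (simp add: pos_root_def)
next
  case (step m)
  have "pos_root n i (Suc m) = pos_root n i m * gen n m"
    using step by (simp add: pos_root_def)
  also have "\<dots> = fps_X ^ (m - i) * fps_X *
    (fps_const (Poly_Mapping.single (Poly_Mapping.single i 1 - Poly_Mapping.single m 1) 1) *
     fps_const (Poly_Mapping.single (Poly_Mapping.single m 1 - Poly_Mapping.single (Suc m) 1) 1))"
    using assms(1) step unfolding step.IH by (simp add: gen_def mult_ac)
  also have "\<dots> = fps_X ^ (Suc m - i) *
     fps_const (Poly_Mapping.single (Poly_Mapping.single i 1 - Poly_Mapping.single (Suc m) 1) 1)"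
    using step by (simp add: mult_single Suc_diff_le)
  finally show ?case .
qed

lemma q_S_eq:
  assumes "1 \<le> n"
  shows "q_S n = fps_X ^ n * fps_const (const [:0, 1:])"
proof -
  have "{0..<n} = insert 0 {1..<n}" using assms by auto
  then have "q_S n = gen n 0 * pos_root n 1 n" by (simp add: q_S_def pos_root_def)
  also have "\<dots> = fps_X ^ Suc (n - 1) * (fps_const (Poly_Mapping.single (Poly_Mapping.single n 1 - Poly_Mapping.single 1 1) [:0, 1:])
     * fps_const (Poly_Mapping.single (Poly_Mapping.single 1 1 - Poly_Mapping.single n 1) 1))"
    using assms unfolding pos_root_eq[OF order_refl assms] by (simp only: gen_def mult_ac power_Suc if_True refl)
  also have "\<dots> = fps_X ^ n * fps_const (const [:0, 1:])" using assms by (simp add: mult_single const_def)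
  finally show ?thesis .
qed

lemma q_neg_root_eq:
  assumes "1 \<le> i" "i < j" "j \<le> n"
  shows "q_neg_root n i j = fps_X ^ (n - (j - i)) *
    fps_const (Poly_Mapping.single (Poly_Mapping.single j 1 - Poly_Mapping.single i 1) [:0, 1:])"
proof -
  have "{0..<i} \<union> {j..<n} = insert 0 ({1..<i} \<union> {j..<n})" using assms by auto
  then have "q_neg_root n i j = gen n 0 * (\<Prod>k\<in>{1..<i} \<union> {j..<n}. gen n k)"
    using assms by (simp add: q_neg_root_def)
  also have "(\<Prod>k\<in>{1..<i} \<union> {j..<n}. gen n k) = pos_root n 1 i * pos_root n j n"
    unfolding pos_root_def using assms by (intro prod.union_disjoint) auto
  also have "gen n 0 * (pos_root n 1 i * pos_root n j n) = fps_X ^ (Suc ((i - 1) + (n - j))) *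
     (fps_const (Poly_Mapping.single (Poly_Mapping.single n 1 - Poly_Mapping.single 1 1) [:0, 1:])
     * fps_const (Poly_Mapping.single (Poly_Mapping.single 1 1 - Poly_Mapping.single i 1) 1)
     * fps_const (Poly_Mapping.single (Poly_Mapping.single j 1 - Poly_Mapping.single n 1) 1))"
    using assms by (simp only: pos_root_eq gen_def power_add power_Suc mult_ac if_True order_refl) (simp add: pos_root_eq mult_ac)
  also have "Suc ((i - 1) + (n - j)) = n - (j - i)" using assms by auto
  finally show ?thesis by (simp add: mult_single algebra_simps)
qed

end

theory Submission
  imports Defs
begin

text \<open>
  Write \<open>y\<^sub>i\<^sub>j = x\<^sub>i / x\<^sub>j\<close> for \<open>i < j\<close>. Both inner products are constant terms of
  \<open>f * bar g * (\<Prod>i<j. 1 - s / y\<^sub>i\<^sub>j)\<close> times the same series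
  \<open>(\<Prod>i<j. 1 - t y\<^sub>i\<^sub>j) * J(q, t)\<close>: on the left \<open>s = q t\<close>, because this is the ratio of the weights
  \<open>J(q, q t)\<close> and \<open>J(q, t)\<close>, and on the right \<open>s = t\<^sup>-\<^sup>1\<close>, because
  \<open>A_rho * bar A_rho = (\<Prod>i<j. (1 - t y\<^sub>i\<^sub>j) (1 - t\<^sup>-\<^sup>1 / y\<^sub>i\<^sub>j))\<close>. The common series is
  \<open>\<Prod>i<j. 1 - y\<^sub>i\<^sub>j\<close> times a symmetric series, so up to a monomial factor it is antisymmetric.
  Expanding \<open>\<Prod>i<j. x\<^sub>i - s x\<^sub>j\<close> as a sum over tournaments, only the terms with pairwise
  distinct scores survive against an antisymmetric series. These are the transitive tournaments, that
  is, permutations, and they add up to \<open>W0 s\<close> times a constant independent of \<open>s\<close>.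
\<close>

section \<open>Inversions and tournaments\<close>

text \<open>The expansion in the generators is not stable under permutations: swapping
  \<open>i\<close> and \<open>i + 1\<close> sends
  \<open>x\<^sub>i / x\<^sub>i\<^sub>+\<^sub>1\<close>, of degree 1, to its inverse, of degree -1.
  Symmetry is therefore studied on coefficient functions, which attach a Laurent series in
  \<open>q\<close> to each exponent; there permutations act through the exponents. These functions
  only form a module over the Laurent polynomials, so the symmetric infinite product is never formed
  as an element. Instead, for each \<open>m\<close>, the common series \<open>c\<close>, multiplied
  by a monomial, satisfies \<open>D c = N\<close> modulo \<open>q ^ m\<close> with Laurent
  polynomials \<open>D\<close> (symmetric) and \<open>N\<close> (antisymmetric). The factors
  \<open>1 - t y\<^sub>i\<^sub>j\<close> remove exactly the denominators free of \<open>q\<close>;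
  the remaining ones give \<open>D = 1\<close> modulo \<open>q\<close>, so \<open>D\<close> can be
  cancelled q-adically, and antisymmetry follows because \<open>m\<close> is arbitrary. Length has
  to be identified with the number of inversions because the power of \<open>s\<close> attached to a
  transitive tournament counts inversions, whereas \<open>W0\<close> is defined by length.\<close>

lemma finite_pairs [simp]: "finite (pairs n)"
  by (rule finite_subset[of _ "{1..n} \<times> {1..n}"]) (auto simp: pairs_def)

definition inversions :: "nat \<Rightarrow> (nat \<Rightarrow> nat) \<Rightarrow> (nat \<times> nat) set"
  where "inversions n w = {(i, j) \<in> pairs n. w j < w i}"

lemma inversions_subset: "inversions n w \<subseteq> pairs n"
  by (auto simp: inversions_def)

lemma inversions_id [simp]: "inversions n id = {}"
  by (auto simp: inversions_def pairs_def)

lemma finite_inversions [simp]: "finite (inversions n w)"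
  using finite_subset[OF inversions_subset] by simp

text \<open>\<open>pairs n\<close> stands for the two-element subsets of \<open>{1..n}\<close>,
  written in increasing order; min and max restore this order after applying
  \<open>w\<close>.\<close>

lemma bij_betw_pairs_permutes:
  assumes "w permutes {1..n}"
  shows "bij_betw (\<lambda>(i, j). (min (w i) (w j), max (w i) (w j))) (pairs n) (pairs n)"
proof -
  let ?g = "\<lambda>(i, j). (min (w i) (w j), max (w i) (w j))"
  have inj: "w i = w j \<longleftrightarrow> i = j" for i j
    using permutes_inj[OF assms] by (auto dest: injD)
  have mem: "w i \<in> {1..n} \<longleftrightarrow> i \<in> {1..n}" for i
    using permutes_in_image[OF assms] .
  have "inj_on ?g (pairs n)"
    by (auto simp: inj_on_def pairs_def min_def max_def inj split: if_splits)
  moreover have "?g ` pairs n \<subseteq> pairs n"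
  proof (rule image_subsetI)
    fix p assume "p \<in> pairs n"
    then show "?g p \<in> pairs n"
      using mem[of "fst p"] mem[of "snd p"] inj[of "fst p" "snd p"]
      by (cases p) (auto simp: pairs_def min_def max_def)
  qed
  ultimately show ?thesis
    by (simp add: bij_betw_def endo_inj_surj)
qed

lemma prod_pairs_permutes:
  fixes F :: "nat \<Rightarrow> nat \<Rightarrow> 'a::comm_monoid_mult"
  assumes "w permutes {1..n}" and sym: "\<And>i j. F i j = F j i"
  shows "(\<Prod>(i, j)\<in>pairs n. F (w i) (w j)) = (\<Prod>(i, j)\<in>pairs n. F i j)"
proof -
  have "(\<Prod>(i, j)\<in>pairs n. F i j) =
      (\<Prod>p\<in>pairs n. case (case p of (i, j) \<Rightarrow> (min (w i) (w j), max (w i) (w j))) of (i, j) \<Rightarrow> F i j)"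
    by (rule prod.reindex_bij_betw[OF bij_betw_pairs_permutes[OF assms(1)], symmetric])
  also have "\<dots> = (\<Prod>(i, j)\<in>pairs n. F (w i) (w j))"
    by (intro prod.cong refl) (auto simp: min_def max_def sym)
  finally show ?thesis ..
qed

text \<open>Putting the two indices of each factor in increasing order costs one sign per inversion;
  the product that remains depends on unordered pairs only and can be reindexed.\<close>

lemma vandermonde_permutes:
  fixes x :: "nat \<Rightarrow> 'a::comm_ring_1"
  assumes "w permutes {1..n}"
  shows "(\<Prod>(i, j)\<in>pairs n. x (w j) - x (w i)) =
    (-1) ^ card (inversions n w) * (\<Prod>(i, j)\<in>pairs n. x j - x i)"
proof -
  define F where "F i j = x (max i j) - x (min i j)" for i j
  have "(\<Prod>(i, j)\<in>pairs n. x (w j) - x (w i)) =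
      (\<Prod>p\<in>pairs n. (if p \<in> inversions n w then -1 else 1) * (case p of (i, j) \<Rightarrow> F (w i) (w j)))"
  proof (intro prod.cong refl, clarify)
    fix i j assume ij: "(i, j) \<in> pairs n"
    then have "w i \<noteq> w j" using permutes_inj[OF assms] by (auto simp: pairs_def dest: injD)
    with ij show "x (w j) - x (w i) = (if (i, j) \<in> inversions n w then -1 else 1) * F (w i) (w j)"
      by (cases "w i" "w j" rule: linorder_cases) (simp_all add: F_def inversions_def)
  qed
  also have "\<dots> = (\<Prod>p\<in>pairs n. if p \<in> inversions n w then -1 else 1) * (\<Prod>(i, j)\<in>pairs n. F (w i) (w j))"
    by (rule prod.distrib)
  also have "(\<Prod>p\<in>pairs n. if p \<in> inversions n w then -1 else 1) = (-1 :: 'a) ^ card (inversions n w)"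
    using inversions_subset[of n w] by (simp add: prod.If_cases Int_absorb1)
  also have "(\<Prod>(i, j)\<in>pairs n. F (w i) (w j)) = (\<Prod>(i, j)\<in>pairs n. F i j)"
    by (rule prod_pairs_permutes[OF assms]) (simp add: F_def min.commute max.commute)
  also have "\<dots> = (\<Prod>(i, j)\<in>pairs n. x j - x i)"
    by (intro prod.cong refl) (auto simp: F_def pairs_def)
  finally show ?thesis .
qed

text \<open>Swapping the adjacent values \<open>i\<close> and \<open>Suc i\<close> leaves every
  comparison with a third value unchanged, so only the two positions holding these values are
  affected.\<close>

lemma inversions_transpose_comp:
  assumes v: "v permutes {1..n}" and ab: "(a, b) \<in> pairs n" "v a = i" "v b = Suc i"
  shows "inversions n (Transposition.transpose i (Suc i) \<circ> v) = insert (a, b) (inversions n v)"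
    and "(a, b) \<notin> inversions n v"
proof -
  have inj: "v c = v d \<longleftrightarrow> c = d" for c d
    using permutes_inj[OF v] by (auto dest: injD)
  have a: "v c = i \<longleftrightarrow> c = a" and b: "v c = Suc i \<longleftrightarrow> c = b" for c
    using inj ab by metis+
  have "a < b" using ab by (auto simp: pairs_def)
  have "Transposition.transpose i (Suc i) (v d) < Transposition.transpose i (Suc i) (v c) \<longleftrightarrow>
      v d < v c \<or> (c, d) = (a, b)" if "c < d" for c d
    using a[of c] a[of d] b[of c] b[of d] that \<open>a < b\<close>
    by (cases "v c = i"; cases "v d = i"; cases "v c = Suc i"; cases "v d = Suc i")
      (auto simp: Transposition.transpose_def)
  then show "inversions n (Transposition.transpose i (Suc i) \<circ> v) = insert (a, b) (inversions n v)"
    using ab(1) by (auto simp: inversions_def pairs_def)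
  show "(a, b) \<notin> inversions n v" using ab by (simp add: inversions_def)
qed

text \<open>The second claim is the first one read for \<open>s \<circ> v\<close>, since
  \<open>s\<close> is an involution.\<close>

lemma card_inversions_transpose_comp:
  assumes v: "v permutes {1..n}" and i: "1 \<le> i" "i < n"
  defines "s \<equiv> Transposition.transpose i (Suc i)"
  shows "inv v i < inv v (Suc i) \<Longrightarrow> card (inversions n (s \<circ> v)) = Suc (card (inversions n v))"
    and "inv v (Suc i) < inv v i \<Longrightarrow> card (inversions n v) = Suc (card (inversions n (s \<circ> v)))"
proof -
  have "inv v i \<in> {1..n}" "inv v (Suc i) \<in> {1..n}"
    using permutes_in_image[OF permutes_inv[OF v]] i by auto
  note mem = this
  note vv = permutes_inverses[OF v]
  show "card (inversions n (s \<circ> v)) = Suc (card (inversions n v))" if "inv v i < inv v (Suc i)"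
    using inversions_transpose_comp[OF v _ vv(1) vv(1), of i] that mem
    by (simp add: s_def pairs_def)
  have sv: "(s \<circ> v) permutes {1..n}"
    unfolding s_def using i by (intro permutes_compose[OF v] permutes_swap_id) auto
  have "s \<circ> (s \<circ> v) = v" by (simp add: s_def fun_eq_iff)
  then show "card (inversions n v) = Suc (card (inversions n (s \<circ> v)))" if "inv v (Suc i) < inv v i"
    using inversions_transpose_comp[OF sv, of "inv v (Suc i)" "inv v i" i] that mem
    by (simp add: s_def pairs_def vv)
qed

section \<open>Words in the simple transpositions, and length as number of inversions\<close>

definition word_perm :: "nat list \<Rightarrow> nat \<Rightarrow> nat"
  where "word_perm is = foldr (\<lambda>i v. Transposition.transpose i (Suc i) \<circ> v) is id"

lemma word_perm_simps [simp]:
  "word_perm [] = id"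
  "word_perm (i # is) = Transposition.transpose i (Suc i) \<circ> word_perm is"
  by (simp_all add: word_perm_def)

lemma word_perm_permutes: "set is \<subseteq> {1..<n} \<Longrightarrow> word_perm is permutes {1..n}"
proof (induction "is")
  case (Cons i "is")
  then show ?case
    by (auto intro!: permutes_compose permutes_swap_id simp del: o_apply)
qed (simp add: permutes_id)

lemma card_inversions_word_perm_le:
  "set is \<subseteq> {1..<n} \<Longrightarrow> card (inversions n (word_perm is)) \<le> length is"
proof (induction "is")
  case (Cons i "is")
  note v = word_perm_permutes[of "is" n]
  have "inv (word_perm is) i \<noteq> inv (word_perm is) (Suc i)"
    using Cons.prems v permutes_inverses(1) by (metis n_not_Suc_n set_subset_Cons subset_trans)
  then consider "inv (word_perm is) i < inv (word_perm is) (Suc i)"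
    | "inv (word_perm is) (Suc i) < inv (word_perm is) i" by linarith
  then show ?case
    using card_inversions_transpose_comp[OF v, of i] Cons
    by cases (simp_all del: o_apply)
qed (simp add: inversions_id)

lemma sign_word_perm: "sign (word_perm is) = (-1) ^ length is"
proof (induction "is")
  case (Cons i "is")
  have "permutation (word_perm is)"
  proof (induction "is")
    case (Cons i "is")
    then show ?case
      unfolding word_perm_simps by (intro permutation_compose permutation_swap_id)
  qed (simp add: permutation_id)
  then show ?case using Cons by (simp add: sign_compose permutation_swap_id sign_swap_id del: o_apply)
qed simp

text \<open>This is sorting by adjacent swaps: a descent of \<open>inv w\<close> yields a letter
  that removes exactly one inversion, and without descents the permutation is already
  sorted.\<close>

lemma ex_word_perm:
  "w permutes {1..n} \<Longrightarrow> \<exists>is. length is = card (inversions n w) \<and> set is \<subseteq> {1..<n} \<and> w = word_perm is"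
proof (induction "card (inversions n w)" arbitrary: w rule: less_induct)
  case less
  show ?case
  proof (cases "\<exists>i. 1 \<le> i \<and> i < n \<and> inv w (Suc i) < inv w i")
    case True
    then obtain i where i: "1 \<le> i" "i < n" "inv w (Suc i) < inv w i" by blast
    let ?v = "Transposition.transpose i (Suc i) \<circ> w"
    have c: "card (inversions n w) = Suc (card (inversions n ?v))"
      using card_inversions_transpose_comp(2)[OF less.prems i] .
    have "?v permutes {1..n}"
      using i by (intro permutes_compose[OF less.prems] permutes_swap_id) auto
    then obtain "is" where "is": "length is = card (inversions n ?v)" "set is \<subseteq> {1..<n}" "?v = word_perm is"
      using less.hyps[of ?v] c by auto
    have "w = Transposition.transpose i (Suc i) \<circ> ?v" by (simp add: fun_eq_iff)
    then show ?thesis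
      using "is" i c by (intro exI[of _ "i # is"]) (auto simp del: o_apply)
  next
    case False
    then have no_descent: "inv w i \<le> inv w (Suc i)" if "1 \<le> i" "i < n" for i
      using that by (meson not_less)
    have p: "inv w permutes {1..n}" by (rule permutes_inv[OF less.prems])
    have inj: "inv w (Suc i) \<noteq> inv w i" for i
      using permutes_inj[OF p] by (metis injD n_not_Suc_n)
    \<comment> \<open>Without descents \<open>inv w\<close> is strictly increasing on
      \<open>{1..n}\<close> and starts at 1 or above, so it dominates the identity; a permutation
      with this property is the identity.\<close>
    have "k \<le> inv w k" if "k \<in> {1..n}" for k
      using that
    proof (induction k)
      case (Suc k)
      show ?case
      proof (cases "k = 0")
        case True
        then show ?thesis using permutes_in_image[OF p, of "Suc k"] Suc.prems by simp
      next
        case False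
        then have "inv w k \<le> inv w (Suc k)"
          using Suc.prems no_descent[of k] by auto
        moreover have "k \<le> inv w k" using Suc False by auto
        ultimately show ?thesis using inj[of k] by linarith
      qed
    qed simp
    then have "inv w = id" using permutes_natset_ge[OF p] by blast
    then have "w = id" using permutes_inv_inv[OF less.prems] by (metis inv_id)
    then show ?thesis by (intro exI[of _ "[]"]) simp
  qed
qed

text \<open>A letter changes the number of inversions by exactly one, which bounds every word for
  \<open>w\<close> from below; the sorting word attains the bound.\<close>

lemma perm_length_eq_card_inversions:
  assumes "w permutes {1..n}"
  shows "perm_length n w = card (inversions n w)"
  unfolding perm_length_def word_perm_def[symmetric]
  using ex_word_perm[OF assms] card_inversions_word_perm_le
  by (intro Least_equality) auto

lemma sign_eq_inversions:
  assumes "w permutes {1..n}"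
  shows "sign w = (-1) ^ card (inversions n w)"
  using ex_word_perm[OF assms] sign_word_perm by metis

text \<open>
  A subset \<open>S\<close> of \<open>pairs n\<close> encodes the tournament in which \<open>i\<close> beats \<open>j\<close>, for \<open>i < j\<close>,
  unless \<open>(i, j) \<in> S\<close>.
\<close>

definition beats :: "nat \<Rightarrow> (nat \<times> nat) set \<Rightarrow> nat \<Rightarrow> nat \<Rightarrow> bool"
  where "beats n S i j \<longleftrightarrow> (i, j) \<in> pairs n - S \<or> (j, i) \<in> S"

definition score :: "nat \<Rightarrow> (nat \<times> nat) set \<Rightarrow> nat \<Rightarrow> nat"
  where "score n S k = card {j. beats n S k j}"

lemma beats_range:
  assumes "S \<subseteq> pairs n" "beats n S i j"
  shows "i \<in> {1..n}" "j \<in> {1..n}" "i \<noteq> j"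
  using assms by (auto simp: beats_def pairs_def)

lemma beats_total:
  assumes "S \<subseteq> pairs n" "i \<in> {1..n}" "j \<in> {1..n}" "i \<noteq> j"
  shows "beats n S i j \<longleftrightarrow> \<not> beats n S j i"
  using assms by (cases "i < j") (auto simp: beats_def pairs_def)

text \<open>The tournament of \<open>inversions n w\<close> ranks the players by \<open>w\<close>,
  with rank 1 as overall winner; hence the score \<open>n - w k\<close> below.\<close>

lemma beats_inversions:
  assumes w: "w permutes {1..n}" and "k \<in> {1..n}" "j \<in> {1..n}"
  shows "beats n (inversions n w) k j \<longleftrightarrow> w k < w j"
proof -
  have "w i = w j \<longleftrightarrow> i = j" for i j
    using permutes_inj[OF w] by (auto dest: injD)
  then show ?thesis
    using assms(2,3) by (cases k j rule: linorder_cases)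
      (auto simp: beats_def inversions_def pairs_def not_less le_less)
qed

lemma score_inversions:
  assumes w: "w permutes {1..n}" and k: "k \<in> {1..n}"
  shows "score n (inversions n w) k = n - w k"
proof -
  have wk: "w k \<in> {1..n}" using permutes_in_image[OF w] k by blast
  have "{j. beats n (inversions n w) k j} = {j \<in> {1..n}. w k < w j}"
    using beats_inversions[OF w k] beats_range(2)[OF inversions_subset] by blast
  moreover have "w ` \<dots> = {w k<..n}"
  proof safe
    fix m assume "m \<in> {w k<..n}"
    then have "inv w m \<in> {1..n}" "w (inv w m) = m"
      using permutes_in_image[OF permutes_inv[OF w]] permutes_inverses(1)[OF w] by auto
    then show "m \<in> w ` {j \<in> {1..n}. w k < w j}"
      using \<open>m \<in> {w k<..n}\<close> by (intro image_eqI[of _ _ "inv w m"]) auto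
  qed (use permutes_in_image[OF w] in auto)
  moreover have "inj_on w A" for A
    using permutes_inj[OF w] by (rule inj_on_subset) simp
  ultimately show ?thesis
    unfolding score_def by (metis card_image card_greaterThanAtMost)
qed

lemma score_less:
  assumes S: "S \<subseteq> pairs n" and k: "k \<in> {1..n}"
  shows "score n S k < n"
proof -
  have "{j. beats n S k j} \<subseteq> {1..n} - {k}" using beats_range[OF S] by blast
  then have "score n S k \<le> card ({1..n} - {k})"
    unfolding score_def by (intro card_mono) auto
  also have "\<dots> = n - 1" using k by simp
  also have "\<dots> < n" using k by simp
  finally show ?thesis .
qed

text \<open>By induction on the score: the players with a smaller score than \<open>k\<close> lose to \<open>k\<close>,
  and there are \<open>score n S k\<close> of them.\<close>

lemma beats_iff_score_less:
  assumes S: "S \<subseteq> pairs n" and inj: "inj_on (score n S) {1..n}"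
  shows "k \<in> {1..n} \<Longrightarrow> {j. beats n S k j} = {j \<in> {1..n}. score n S j < score n S k}"
proof (induction "score n S k" arbitrary: k rule: less_induct)
  case less
  let ?L = "{j \<in> {1..n}. score n S j < score n S k}"
  \<comment> \<open>The \<open>n\<close> distinct scores all lie below \<open>n\<close>, so every
    value below \<open>n\<close> is taken once.\<close>
  have "score n S ` {1..n} = {..<n}"
    using score_less[OF S] by (intro card_subset_eq) (use card_image[OF inj] in auto)
  moreover have "score n S ` ?L = score n S ` {1..n} \<inter> {..<score n S k}"
    by auto
  ultimately have "score n S ` ?L = {..<score n S k}"
    using score_less[OF S less.prems] by auto
  moreover have "inj_on (score n S) ?L" using inj by (rule inj_on_subset) auto
  ultimately have card: "card ?L = score n S k" by (metis card_image card_lessThan)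
  have "?L \<subseteq> {j. beats n S k j}"
  proof safe
    fix j assume j: "j \<in> {1..n}" "score n S j < score n S k"
    have "k \<notin> {i \<in> {1..n}. score n S i < score n S j}" using j by simp
    then have "\<not> beats n S j k" unfolding less.hyps[OF j(2,1), symmetric] by simp
    then show "beats n S k j" using beats_total[OF S less.prems j(1)] j(2) by blast
  qed
  moreover have "finite {j. beats n S k j}"
    by (rule finite_subset[of _ "{1..n}"]) (use beats_range[OF S] in auto)
  ultimately show ?case using card by (metis card_subset_eq score_def)
qed

text \<open>Tournaments with distinct scores are the transitive ones, and a transitive tournament is
  the same as a ranking of its players.\<close>

lemma bij_betw_inversions:
  "bij_betw (inversions n) {w. w permutes {1..n}} {S. S \<subseteq> pairs n \<and> inj_on (score n S) {1..n}}"
proof (rule bij_betw_imageI)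
  show "inj_on (inversions n) {w. w permutes {1..n}}"
  proof (rule inj_onI, rule ext)
    fix v w k assume "v \<in> {w. w permutes {1..n}}" "w \<in> {w. w permutes {1..n}}"
      and eq: "inversions n v = inversions n w"
    then have v: "v permutes {1..n}" and w: "w permutes {1..n}" by auto
    show "v k = w k"
    proof (cases "k \<in> {1..n}")
      case True
      then have "n - v k = n - w k" "v k \<in> {1..n}" "w k \<in> {1..n}"
        using score_inversions v w eq permutes_in_image by metis+
      then show ?thesis by auto
    qed (use v w in \<open>simp add: permutes_def\<close>)
  qed
  show "inversions n ` {w. w permutes {1..n}} = {S. S \<subseteq> pairs n \<and> inj_on (score n S) {1..n}}"
  proof safe
    fix w a b assume "w permutes {1..n}"
    show "(a, b) \<in> inversions n w \<Longrightarrow> (a, b) \<in> pairs n" using inversions_subset by blast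
  next
    fix w assume w: "w permutes {1..n}"
    show "inj_on (score n (inversions n w)) {1..n}"
    proof (rule inj_onI)
      fix x y assume xy: "x \<in> {1..n}" "y \<in> {1..n}" "score n (inversions n w) x = score n (inversions n w) y"
      then have "n - w x = n - w y" "w x \<in> {1..n}" "w y \<in> {1..n}"
        using score_inversions w permutes_in_image by metis+
      then have "w x = w y" by auto
      then show "x = y" using permutes_inj[OF w] by (auto dest: injD)
    qed
  next
    fix S assume S: "S \<subseteq> pairs n" and inj: "inj_on (score n S) {1..n}"
    \<comment> \<open>The ranking is recovered by solving \<open>score_inversions\<close> for
      \<open>w k\<close>.\<close>
    define w where "w k = (if k \<in> {1..n} then n - score n S k else k)" for k
    have "inj_on w {1..n}"
    proof (rule inj_onI)
      fix x y assume xy: "x \<in> {1..n}" "y \<in> {1..n}" "w x = w y"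
      then have "score n S x = score n S y"
        using score_less[OF S xy(1)] score_less[OF S xy(2)] by (simp add: w_def)
      then show "x = y" using inj xy by (auto dest: inj_onD)
    qed
    moreover have "w ` {1..n} \<subseteq> {1..n}"
      using score_less[OF S] by (force simp: w_def)
    ultimately have "bij_betw w {1..n} {1..n}"
      by (simp add: bij_betw_def endo_inj_surj)
    then have w: "w permutes {1..n}" by (rule bij_imp_permutes) (auto simp: w_def)
    have "(i, j) \<in> S \<longleftrightarrow> w j < w i" if ij: "(i, j) \<in> pairs n" for i j
    proof -
      have r: "i \<in> {1..n}" "j \<in> {1..n}" "i < j" using ij by (auto simp: pairs_def)
      have "(i, j) \<in> S \<longleftrightarrow> beats n S j i" using S r(3) by (auto simp: beats_def pairs_def)
      also have "\<dots> \<longleftrightarrow> score n S i < score n S j"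
        using beats_iff_score_less[OF S inj r(2)] r(1) by auto
      also have "\<dots> \<longleftrightarrow> w j < w i"
        using score_less[OF S r(1)] score_less[OF S r(2)] r by (auto simp: w_def)
      finally show ?thesis .
    qed
    then have "S = inversions n w" using S by (auto simp: inversions_def)
    then show "S \<in> inversions n ` {w. w permutes {1..n}}" using w by blast
  qed
qed


section \<open>Laurent polynomials acting on formal series\<close>

lemma lpoly_induct [case_names zero single add]:
  fixes h :: "'b \<Rightarrow>\<^sub>0 'a::comm_monoid_add"
  assumes "P 0" "\<And>\<mu> a. P (Poly_Mapping.single \<mu> a)" "\<And>f g. P f \<Longrightarrow> P g \<Longrightarrow> P (f + g)"
  shows "P h"
proof -
  have "P (\<Sum>\<mu>\<in>A. Poly_Mapping.single \<mu> (Poly_Mapping.lookup h \<mu>))" if "finite A" for A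
    using that by induction (simp_all add: assms)
  moreover have "h = (\<Sum>\<mu>\<in>Poly_Mapping.keys h. Poly_Mapping.single \<mu> (Poly_Mapping.lookup h \<mu>))"
    by (rule poly_mapping_eqI) (simp add: lookup_sum lookup_single when_def in_keys_iff)
  ultimately show ?thesis by (metis finite_keys)
qed

text \<open>The convolution of \<open>mult_series\<close>, but on coefficient functions with values
  in Laurent series in \<open>q\<close>, so that the result can be acted on again.\<close>

definition act :: "ratfun_qs lpoly \<Rightarrow> (exponent \<Rightarrow> ratfun_s fls) \<Rightarrow> exponent \<Rightarrow> ratfun_s fls"
  where "act h c \<nu> = (\<Sum>\<mu>\<in>Poly_Mapping.keys h. expand_q (Poly_Mapping.lookup h \<mu>) * c (\<nu> - \<mu>))"

lemmas expand_q_hom [simp] = inj_homD[OF inj_hom_expand_q]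

lemma expand_q_uminus [simp]: "expand_q (- a) = - expand_q a"
  by (metis add.inverse_unique expand_q_hom(2,4) add.right_inverse)

lemma expand_q_power [simp]: "expand_q (a ^ k) = expand_q a ^ k"
  by (induction k) simp_all

lemma expand_q_sum [simp]: "expand_q (sum f A) = (\<Sum>x\<in>A. expand_q (f x))"
  by (induction A rule: infinite_finite_induct) simp_all

lemma act_eq_sum:
  assumes "finite A" "Poly_Mapping.keys h \<subseteq> A"
  shows "act h c \<nu> = (\<Sum>\<mu>\<in>A. expand_q (Poly_Mapping.lookup h \<mu>) * c (\<nu> - \<mu>))"
  unfolding act_def using assms by (intro sum.mono_neutral_left) (auto simp: in_keys_iff)

lemma act_zero [simp]: "act 0 c = (\<lambda>_. 0)"
  by (simp add: act_def fun_eq_iff)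

lemma act_single [simp]: "act (Poly_Mapping.single \<mu> a) c = (\<lambda>\<nu>. expand_q a * c (\<nu> - \<mu>))"
  by (rule ext, subst act_eq_sum[of "{\<mu>}"]) (auto simp: lookup_single)

lemma act_add: "act (f + g) c = (\<lambda>\<nu>. act f c \<nu> + act g c \<nu>)"
proof
  fix \<nu>
  let ?A = "Poly_Mapping.keys f \<union> Poly_Mapping.keys g"
  have "finite ?A" by simp
  note E = act_eq_sum[OF this, where c = c and \<nu> = \<nu>]
  show "act (f + g) c \<nu> = act f c \<nu> + act g c \<nu>"
    by (subst E, rule Poly_Mapping.keys_add, subst E, simp, subst E, simp)
      (simp add: lookup_add algebra_simps sum.distrib)
qed

lemma act_one [simp]: "act 1 c = c"
proof -
  have "1 = Poly_Mapping.single (0::exponent) (1::ratfun_qs)" by simp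
  then show ?thesis using act_single[of 0 1 c] by (simp del: single_one)
qed

lemma act_uminus: "act (- f) c = (\<lambda>\<nu>. - act f c \<nu>)"
  by (rule ext) (simp add: act_def sum_negf)

lemma act_diff: "act (f - g) c = (\<lambda>\<nu>. act f c \<nu> - act g c \<nu>)"
  using act_add[of f "- g" c] by (simp add: act_uminus)

lemma act_sum: "act (sum f A) c = (\<lambda>\<nu>. \<Sum>x\<in>A. act (f x) c \<nu>)"
  by (induction A rule: infinite_finite_induct) (simp_all add: act_add)

lemma act_fun_diff: "act h (\<lambda>\<mu>. c \<mu> - d \<mu>) = (\<lambda>\<nu>. act h c \<nu> - act h d \<nu>)"
  by (rule ext) (simp add: act_def algebra_simps sum_subtractf)

lemma act_fun_scale: "act h (\<lambda>\<mu>. a * c \<mu>) = (\<lambda>\<nu>. a * act h c \<nu>)"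
  by (rule ext) (simp add: act_def sum_distrib_left mult_ac)

lemma act_fun_add: "act h (\<lambda>\<mu>. c \<mu> + d \<mu>) = (\<lambda>\<nu>. act h c \<nu> + act h d \<nu>)"
  by (rule ext) (simp add: act_def algebra_simps sum.distrib)

text \<open>This makes the coefficient functions a module over the Laurent polynomials; additivity
  in both factors reduces it to monomials.\<close>

lemma act_mult: "act (f * g) c = act f (act g c)"
proof (induction f rule: lpoly_induct)
  case (single \<mu> a)
  show ?case
  proof (induction g rule: lpoly_induct)
    case (single \<nu> b)
    show ?case by (simp add: mult_single fun_eq_iff mult_ac diff_diff_eq)
  qed (simp_all add: distrib_left act_add act_fun_add del: act_single, simp add: act_def)
qed (simp_all add: act_add distrib_right)

text \<open>The coefficient function of the series 1. Hence \<open>act h delta\<close> is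
  \<open>h\<close> itself seen as a coefficient function, and divisibility of \<open>h\<close> by
  powers of \<open>q\<close> is expressed through it.\<close>

definition delta :: "exponent \<Rightarrow> ratfun_s fls"
  where "delta \<mu> = (if \<mu> = 0 then 1 else 0)"

lemma act_delta: "act h delta = (\<lambda>\<mu>. expand_q (Poly_Mapping.lookup h \<mu>))"
proof (rule ext)
  fix \<nu>
  show "act h delta \<nu> = expand_q (Poly_Mapping.lookup h \<nu>)"
    by (subst act_eq_sum[of "insert \<nu> (Poly_Mapping.keys h)"])
      (auto simp: delta_def if_distrib[of "(*) _"] sum.delta' cong: if_cong)
qed

section \<open>Divisibility by powers of q, uniformly in the exponent\<close>

definition q_divisible :: "nat \<Rightarrow> (exponent \<Rightarrow> ratfun_s fls) \<Rightarrow> bool"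
  where "q_divisible m c \<longleftrightarrow> (\<forall>\<mu> k. k < int m \<longrightarrow> fls_nth (c \<mu>) k = 0)"

lemma fls_nth_sum: "fls_nth (sum f A) k = (\<Sum>x\<in>A. fls_nth (f x) k)"
  by (induction A rule: infinite_finite_induct) simp_all

lemma fls_mult_nth_eq_0:
  fixes f g :: "'a::field fls"
  assumes "\<And>k. k < a \<Longrightarrow> fls_nth f k = 0" "\<And>k. k < b \<Longrightarrow> fls_nth g k = 0" "k < a + b"
  shows "fls_nth (f * g) k = 0"
proof (cases "f = 0 \<or> g = 0")
  case False
  then have "a \<le> fls_subdegree f" "b \<le> fls_subdegree g"
    using assms(1,2) by (auto intro!: fls_subdegree_geI)
  then have "k < fls_subdegree (f * g)"
    using False assms(3) by simp
  then show ?thesis by (rule fls_eq0_below_subdegree)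
qed auto

lemma q_divisible_act:
  assumes "q_divisible a (act h delta)" "q_divisible b c"
  shows "q_divisible (a + b) (act h c)"
  using assms unfolding q_divisible_def act_delta
  by (auto simp: act_def fls_nth_sum intro!: sum.neutral fls_mult_nth_eq_0[of "int a" _ "int b"])

lemma q_divisible_diff:
  "q_divisible m c \<Longrightarrow> q_divisible m d \<Longrightarrow> q_divisible m (\<lambda>\<mu>. c \<mu> - d \<mu>)"
  by (simp add: q_divisible_def)

text \<open>Write \<open>c = D c - (D - 1) c\<close>. The second term is divisible by one more power
  of \<open>q\<close> than \<open>c\<close>, so the divisibility of \<open>c\<close> improves step
  by step until it reaches that of \<open>D c\<close>.\<close>

lemma q_divisible_cancel:
  assumes D: "q_divisible 1 (act (D - 1) delta)" and "q_divisible 0 c" "q_divisible m (act D c)"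
  shows "q_divisible m c"
proof -
  have "q_divisible j c" if "j \<le> m" for j
    using that
  proof (induction j)
    case (Suc j)
    then have "q_divisible (1 + j) (act (D - 1) c)" by (intro q_divisible_act[OF D]) simp
    moreover have "q_divisible (1 + j) (act D c)"
      using assms(3) Suc.prems by (auto simp: q_divisible_def)
    ultimately have "q_divisible (1 + j) (\<lambda>\<mu>. act D c \<mu> - act (D - 1) c \<mu>)"
      by (rule q_divisible_diff[rotated])
    then show ?case by (simp add: act_diff)
  qed (use assms(2) in simp)
  then show ?thesis by simp
qed

section \<open>Permutations of the variables\<close>

lemma inj_map_key:
  assumes "w permutes {1..n}"
  shows "inj (Poly_Mapping.map_key w :: exponent \<Rightarrow> exponent)"
proof (rule injI, rule poly_mapping_eqI)
  fix \<mu> \<nu> :: exponent and k assume "Poly_Mapping.map_key w \<mu> = Poly_Mapping.map_key w \<nu>"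
  then have "Poly_Mapping.lookup \<mu> (w (inv w k)) = Poly_Mapping.lookup \<nu> (w (inv w k))"
    using lookup_permute_vars(2)[OF assms] by metis
  then show "Poly_Mapping.lookup \<mu> k = Poly_Mapping.lookup \<nu> k"
    using permutes_inverses(1)[OF assms] by simp
qed

context
  fixes w :: "nat \<Rightarrow> nat" and n :: nat
  assumes w: "w permutes {1..n}"
begin

lemma map_key_inv [simp]:
  "Poly_Mapping.map_key w (Poly_Mapping.map_key (inv w) \<mu>) = (\<mu> :: exponent)"
  "Poly_Mapping.map_key (inv w) (Poly_Mapping.map_key w \<mu>) = (\<mu> :: exponent)"
  by (rule poly_mapping_eqI;
      simp add: lookup_permute_vars(2)[OF w] lookup_permute_vars(2)[OF permutes_inv[OF w]] permutes_inverses[OF w])+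

lemma map_key_exponent_simps:
  fixes \<mu> \<nu> :: exponent
  shows "Poly_Mapping.map_key w (\<mu> + \<nu>) = Poly_Mapping.map_key w \<mu> + Poly_Mapping.map_key w \<nu>"
    and "Poly_Mapping.map_key w (\<mu> - \<nu>) = Poly_Mapping.map_key w \<mu> - Poly_Mapping.map_key w \<nu>"
    and "Poly_Mapping.map_key w (- \<mu>) = - Poly_Mapping.map_key w \<mu>"
  by (rule poly_mapping_eqI; simp add: lookup_permute_vars(2)[OF w] lookup_add lookup_minus)+

lemma permute_vars_single:
  "permute_vars w (Poly_Mapping.single \<mu> a) = Poly_Mapping.single (Poly_Mapping.map_key (inv w) \<mu>) a"
proof (rule poly_mapping_eqI)
  fix \<nu> :: exponent
  have "\<mu> = Poly_Mapping.map_key w \<nu> \<longleftrightarrow> Poly_Mapping.map_key (inv w) \<mu> = \<nu>" by auto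
  then show "Poly_Mapping.lookup (permute_vars w (Poly_Mapping.single \<mu> a)) \<nu> =
      Poly_Mapping.lookup (Poly_Mapping.single (Poly_Mapping.map_key (inv w) \<mu>) a) \<nu>"
    by (simp add: lookup_permute_vars(1)[OF w] lookup_single)
qed

lemma permute_vars_zero: "permute_vars w 0 = 0"
  by (rule poly_mapping_eqI) (simp add: lookup_permute_vars(1)[OF w])

lemma permute_vars_const: "permute_vars w (const a) = const a"
proof -
  have "Poly_Mapping.map_key (inv w) 0 = (0 :: exponent)"
    by (rule poly_mapping_eqI) (simp add: lookup_permute_vars(2)[OF permutes_inv[OF w]])
  then show ?thesis by (simp add: const_def permute_vars_single)
qed

lemma permute_vars_one: "permute_vars w (1 :: 'a::comm_ring_1 lpoly) = 1"
  using permute_vars_const[of "1 :: 'a"] by (simp add: const_def)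

lemma permute_vars_add:
  fixes f g :: "'a::comm_monoid_add lpoly"
  shows "permute_vars w (f + g) = permute_vars w f + permute_vars w g"
  by (rule poly_mapping_eqI) (simp add: lookup_permute_vars(1)[OF w] lookup_add)

lemma permute_vars_diff:
  fixes f g :: "'a::ab_group_add lpoly"
  shows "permute_vars w (f - g) = permute_vars w f - permute_vars w g"
  by (rule poly_mapping_eqI) (simp add: lookup_permute_vars(1)[OF w] lookup_minus)

lemma permute_vars_mult:
  fixes f g :: "'a::comm_ring_1 lpoly"
  shows "permute_vars w (f * g) = permute_vars w f * permute_vars w g"
proof (induction f rule: lpoly_induct)
  case (single \<mu> a)
  have i: "Poly_Mapping.map_key (inv w) (\<mu> + \<nu>) =
      Poly_Mapping.map_key (inv w) \<mu> + Poly_Mapping.map_key (inv w) (\<nu> :: exponent)" for \<nu>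
    by (rule poly_mapping_eqI) (simp add: lookup_permute_vars(2)[OF permutes_inv[OF w]] lookup_add)
  show ?case
    by (induction g rule: lpoly_induct)
      (simp_all add: permute_vars_zero distrib_left permute_vars_add permute_vars_single mult_single i)
qed (simp_all add: permute_vars_zero distrib_right permute_vars_add)

lemma permute_vars_prod:
  fixes f :: "'b \<Rightarrow> 'a::comm_ring_1 lpoly"
  shows "permute_vars w (prod f A) = (\<Prod>x\<in>A. permute_vars w (f x))"
  by (induction A rule: infinite_finite_induct) (simp_all add: permute_vars_one permute_vars_mult)

text \<open>Equivariance of the action: precomposition with \<open>map_key w\<close> is for
  coefficient functions what \<open>permute_vars w\<close> is for Laurent polynomials.\<close>

lemma act_permute_vars:
  "act (permute_vars w h) (\<lambda>\<mu>. c (Poly_Mapping.map_key w \<mu>)) = (\<lambda>\<nu>. act h c (Poly_Mapping.map_key w \<nu>))"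
  by (induction h rule: lpoly_induct)
    (simp_all add: permute_vars_zero permute_vars_add permute_vars_single act_add map_key_exponent_simps)

lemma delta_map_key: "delta (Poly_Mapping.map_key w \<mu>) = delta \<mu>"
proof -
  have "Poly_Mapping.map_key w (0 :: exponent) = 0"
    by (rule poly_mapping_eqI) (simp add: lookup_permute_vars(2)[OF w])
  moreover have "\<mu> = 0" if "Poly_Mapping.map_key w \<mu> = 0"
    using injD[OF inj_map_key[OF w], of \<mu> 0] that calculation by simp
  ultimately show ?thesis by (auto simp: delta_def)
qed

text \<open>Think of \<open>c\<close> as the q-adic limit of the fractions \<open>N / D\<close>. The
  defect \<open>e\<close> of the claimed identity satisfies \<open>D e = 0\<close> modulo every
  power of \<open>q\<close>; after cancelling \<open>D\<close>, all coefficients of \<open>e\<close>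
  vanish.\<close>

lemma antisymmetric_of_congruences:
  assumes c0: "q_divisible 0 c"
    and cong: "\<And>m. \<exists>D N. permute_vars w D = D \<and> permute_vars w N = const a * N \<and>
      q_divisible 1 (act (D - 1) delta) \<and> q_divisible m (\<lambda>\<mu>. act D c \<mu> - act N delta \<mu>)"
    and a0: "q_divisible 0 (act (const a) delta)"
  shows "c (Poly_Mapping.map_key w \<mu>) = expand_q a * c \<mu>"
proof -
  define e where "e = (\<lambda>\<mu>. c (Poly_Mapping.map_key w \<mu>) - act (const a) c \<mu>)"
  have scale: "q_divisible m (act (const a) d)" if "q_divisible m d" for m d
    using q_divisible_act[OF a0 that] by simp
  have perm: "q_divisible m (\<lambda>\<mu>. d (Poly_Mapping.map_key w \<mu>))" if "q_divisible m d" for m d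
    using that by (simp add: q_divisible_def)
  have "\<forall>m. q_divisible m e"
  proof
    fix m
    from cong[of m] obtain D N where D: "permute_vars w D = D" and N: "permute_vars w N = const a * N"
      and D1: "q_divisible 1 (act (D - 1) delta)"
      and DN: "q_divisible m (\<lambda>\<mu>. act D c \<mu> - act N delta \<mu>)" by blast
    have "act N delta (Poly_Mapping.map_key w \<mu>) = act (const a) (act N delta) \<mu>" for \<mu>
      using act_permute_vars[of N delta] by (simp add: N delta_map_key act_mult)
    moreover have "act D c (Poly_Mapping.map_key w \<mu>) = act D (\<lambda>\<mu>. c (Poly_Mapping.map_key w \<mu>)) \<mu>" for \<mu>
      using act_permute_vars[of D c] by (simp add: D)
    moreover have "act D (act (const a) c) = act (const a) (act D c)"
      by (metis act_mult mult.commute)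
    ultimately have "act D e = (\<lambda>\<mu>. (act D c (Poly_Mapping.map_key w \<mu>) - act N delta (Poly_Mapping.map_key w \<mu>))
        - act (const a) (\<lambda>\<mu>. act D c \<mu> - act N delta \<mu>) \<mu>)"
      by (simp add: e_def act_fun_diff)
    then have De: "q_divisible m (act D e)"
      using q_divisible_diff[OF perm[OF DN] scale[OF DN]] by simp
    have e0: "q_divisible 0 e"
      unfolding e_def by (rule q_divisible_diff[OF perm[OF c0] scale[OF c0]])
    show "q_divisible m e" by (rule q_divisible_cancel[OF D1 e0 De])
  qed
  then have "fls_nth (e \<mu>) k = 0" for k
    by (elim allE[of _ "Suc (nat k)"]) (simp add: q_divisible_def)
  then have "e \<mu> = 0" by (intro fls_eqI) simp
  then show ?thesis by (simp add: e_def const_def)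
qed

end

text \<open>The characteristic is not 2: \<open>1 + 1\<close> is the image of a nonzero complex
  constant under an injective homomorphism.\<close>

lemma fls_eq_uminus_imp_0:
  fixes x :: "ratfun_s fls"
  assumes "x = - x"
  shows "x = 0"
proof -
  have "(1 + 1 :: ratfun_s) = fract_const (1 + 1)"
    by (simp only: inj_homD[OF inj_hom_fract_const])
  moreover have "fract_const (1 + 1 :: complex) \<noteq> 0"
    unfolding inj_homD(5)[OF inj_hom_fract_const] by simp
  ultimately have two: "(1 + 1 :: ratfun_s) \<noteq> 0" by simp
  show ?thesis
  proof (rule fls_eqI)
    fix k
    have "fls_nth x k = - fls_nth x k" using arg_cong[OF assms, of "\<lambda>x. fls_nth x k"] by simp
    then have "(1 + 1) * fls_nth x k = 0" by (simp add: distrib_right eq_neg_iff_add_eq_0)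
    then show "fls_nth x k = fls_nth 0 k" using two by (simp only: mult_eq_0_iff fls_zero_nth) simp
  qed
qed

section \<open>Antisymmetric coefficient functions and the sum over tournaments\<close>

definition antisymmetric :: "nat \<Rightarrow> (exponent \<Rightarrow> ratfun_s fls) \<Rightarrow> bool"
  where "antisymmetric n c \<longleftrightarrow>
    (\<forall>w \<mu>. w permutes {1..n} \<longrightarrow> c (Poly_Mapping.map_key w \<mu>) = of_int (sign w) * c \<mu>)"

text \<open>Exponent of the term in the expansion of
  \<open>\<Prod>i<j. x\<^sub>i - s x\<^sub>j\<close> that takes \<open>- s x\<^sub>j\<close> at the
  pairs in \<open>S\<close>: each game contributes the variable of its winner.\<close>

definition score_exponent :: "nat \<Rightarrow> (nat \<times> nat) set \<Rightarrow> exponent"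
  where "score_exponent n S = (\<Sum>(i, j)\<in>S. Poly_Mapping.single j 1) + (\<Sum>(i, j)\<in>pairs n - S. Poly_Mapping.single i 1)"

lemma lookup_score_exponent:
  assumes "S \<subseteq> pairs n"
  shows "Poly_Mapping.lookup (score_exponent n S) k = int (score n S k)"
proof -
  have fin: "finite S" "finite (pairs n - S)" using assms finite_subset[OF _ finite_pairs] by auto
  have "Poly_Mapping.lookup (score_exponent n S) k =
      (\<Sum>p\<in>S. if snd p = k then 1 else 0) + (\<Sum>p\<in>pairs n - S. if fst p = k then 1 else 0)"
    by (simp add: score_exponent_def lookup_add lookup_sum case_prod_beta lookup_single when_def eq_commute[of k])
  also have "\<dots> = int (card {p \<in> S. snd p = k}) + int (card {p \<in> pairs n - S. fst p = k})"
    using fin by (simp add: sum.If_cases Int_def)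
  also have "card {p \<in> S. snd p = k} = card {i. (i, k) \<in> S}"
    by (rule bij_betw_same_card[of fst]) (auto simp: bij_betw_def inj_on_def image_iff)
  also have "card {p \<in> pairs n - S. fst p = k} = card {j. (k, j) \<in> pairs n - S}"
    by (rule bij_betw_same_card[of snd]) (auto simp: bij_betw_def inj_on_def image_iff)
  also have "int (card {i. (i, k) \<in> S}) + int (card {j. (k, j) \<in> pairs n - S}) = int (score n S k)"
  proof -
    have "{j. beats n S k j} = {i. (i, k) \<in> S} \<union> {j. (k, j) \<in> pairs n - S}"
      by (auto simp: beats_def)
    moreover have "{i. (i, k) \<in> S} \<inter> {j. (k, j) \<in> pairs n - S} = {}"
      using assms by (auto simp: pairs_def)
    moreover have "finite {i. (i, k) \<in> S}" "finite {j. (k, j) \<in> pairs n - S}"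
      using assms by (auto intro!: finite_subset[of _ "{..n}"] simp: pairs_def)
    ultimately show ?thesis by (simp add: score_def card_Un_disjoint)
  qed
  finally show ?thesis .
qed

text \<open>The negated scores of the tournament of the identity permutation; all surviving terms
  are compared with this one.\<close>

definition staircase :: "nat \<Rightarrow> exponent"
  where "staircase n = (\<Sum>k\<in>{1..n}. Poly_Mapping.single k (int k - int n))"

lemma lookup_staircase:
  "Poly_Mapping.lookup (staircase n) k = (if k \<in> {1..n} then int k - int n else 0)"
  by (simp add: staircase_def lookup_sum lookup_single when_def)

lemma score_exponent_inversions:
  assumes w: "w permutes {1..n}"
  shows "- score_exponent n (inversions n w) = Poly_Mapping.map_key w (staircase n)"
proof (rule poly_mapping_eqI)
  fix k
  have "score n (inversions n w) k = 0" if "k \<notin> {1..n}"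
  proof -
    have "{j. beats n (inversions n w) k j} = {}"
      using beats_range(1)[OF inversions_subset] that by blast
    then show ?thesis by (simp add: score_def)
  qed
  then show "Poly_Mapping.lookup (- score_exponent n (inversions n w)) k =
      Poly_Mapping.lookup (Poly_Mapping.map_key w (staircase n)) k"
    using score_inversions[OF w, of k] permutes_in_image[OF w, of k]
    by (cases "k \<in> {1..n}")
      (auto simp: lookup_permute_vars(2)[OF w] lookup_staircase lookup_score_exponent[OF inversions_subset])
qed

text \<open>The transposition of \<open>a\<close> and \<open>b\<close> fixes \<open>\<mu>\<close>
  and has sign -1.\<close>

lemma antisymmetric_repeated_eq_0:
  assumes c: "antisymmetric n c" and ab: "a \<in> {1..n}" "b \<in> {1..n}" "a \<noteq> b"
    and eq: "Poly_Mapping.lookup \<mu> a = Poly_Mapping.lookup \<mu> b"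
  shows "c \<mu> = 0"
proof -
  have w: "Transposition.transpose a b permutes {1..n}" using ab by (intro permutes_swap_id)
  have "Poly_Mapping.map_key (Transposition.transpose a b) \<mu> = \<mu>"
    by (rule poly_mapping_eqI) (auto simp: lookup_permute_vars(2)[OF w] eq Transposition.transpose_def)
  then have "c \<mu> = - c \<mu>"
    using c w ab(3) unfolding antisymmetric_def by (metis sign_swap_id mult_minus1 of_int_1 of_int_minus)
  then show ?thesis by (rule fls_eq_uminus_imp_0)
qed

text \<open>At exponent 0 each monomial is paired with the value of \<open>c\<close> at the opposite
  exponent. For the tournament of \<open>w\<close>, the sign in
  \<open>(- s) ^ card (inversions n w)\<close> cancels the sign by which \<open>c\<close> differs
  from its value at \<open>staircase n\<close>, leaving \<open>s\<close> to the length of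
  \<open>w\<close>.\<close>

lemma act_twisted_vandermonde:
  assumes c: "antisymmetric n c"
  shows "act (\<Prod>(i, j)\<in>pairs n. var i - const s * var j) c 0 = expand_q (W0 n s) * c (staircase n)"
proof -
  let ?P = "\<Prod>(i, j)\<in>pairs n. var i - const s * var j :: ratfun_qs lpoly"
  have single_prod: "(\<Prod>p\<in>A. Poly_Mapping.single (\<mu> p) a) = Poly_Mapping.single (\<Sum>p\<in>A. \<mu> p) (a ^ card A)"
    if "finite A" for A and \<mu> :: "nat \<times> nat \<Rightarrow> exponent" and a :: ratfun_qs
    using that by (induction A) (simp_all add: mult_single)
  \<comment> \<open>The summand with \<open>- s\<close> is put first so that in the expansion over
    subsets \<open>S\<close> consists of the pairs where it is chosen.\<close>
  have "?P = (\<Prod>p\<in>pairs n. Poly_Mapping.single (Poly_Mapping.single (snd p) 1) (- s) +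
      Poly_Mapping.single (Poly_Mapping.single (fst p) 1) 1)"
    by (intro prod.cong refl) (simp add: case_prod_beta var_def const_def mult_single single_uminus)
  also have "\<dots> = (\<Sum>S\<in>Pow (pairs n). Poly_Mapping.single (score_exponent n S) ((- s) ^ card S))"
  proof (subst prod_add, simp, intro sum.cong refl)
    fix S assume "S \<in> Pow (pairs n)"
    then have "finite S" using finite_subset[OF _ finite_pairs] by auto
    then show "(\<Prod>p\<in>S. Poly_Mapping.single (Poly_Mapping.single (snd p) 1) (- s)) *
        (\<Prod>p\<in>pairs n - S. Poly_Mapping.single (Poly_Mapping.single (fst p) 1) 1) =
        Poly_Mapping.single (score_exponent n S) ((- s) ^ card S)"
      by (simp add: single_prod mult_single score_exponent_def case_prod_beta)
  qed
  finally have "act ?P c 0 = (\<Sum>S\<in>Pow (pairs n). expand_q ((- s) ^ card S) * c (- score_exponent n S))"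
    by (simp add: act_sum)
  also have "\<dots> = (\<Sum>S | S \<subseteq> pairs n \<and> inj_on (score n S) {1..n}.
      expand_q ((- s) ^ card S) * c (- score_exponent n S))"
  proof (rule sum.mono_neutral_right)
    show "\<forall>S\<in>Pow (pairs n) - {S. S \<subseteq> pairs n \<and> inj_on (score n S) {1..n}}.
        expand_q ((- s) ^ card S) * c (- score_exponent n S) = 0"
    proof
      fix S assume S: "S \<in> Pow (pairs n) - {S. S \<subseteq> pairs n \<and> inj_on (score n S) {1..n}}"
      then obtain a b where ab: "a \<in> {1..n}" "b \<in> {1..n}" "a \<noteq> b" "score n S a = score n S b"
        by (auto simp: inj_on_def)
      have "c (- score_exponent n S) = 0"
        using S ab(4) by (intro antisymmetric_repeated_eq_0[OF c ab(1-3)]) (simp add: lookup_score_exponent)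
      then show "expand_q ((- s) ^ card S) * c (- score_exponent n S) = 0" by simp
    qed
  qed auto
  also have "\<dots> = (\<Sum>w | w permutes {1..n}. expand_q ((- s) ^ card (inversions n w)) *
      c (- score_exponent n (inversions n w)))"
    by (rule sum.reindex_bij_betw[OF bij_betw_inversions, symmetric])
  also have "\<dots> = (\<Sum>w | w permutes {1..n}. expand_q (s ^ perm_length n w) * c (staircase n))"
  proof (intro sum.cong refl)
    fix w assume "w \<in> {w. w permutes {1..n}}"
    then have w: "w permutes {1..n}" by simp
    have "c (- score_exponent n (inversions n w)) = (-1) ^ card (inversions n w) * c (staircase n)"
      using c w unfolding score_exponent_inversions[OF w] antisymmetric_def
      by (simp add: sign_eq_inversions)
    moreover have "expand_q ((- s) ^ k) * ((-1) ^ k * x) = expand_q (s ^ k) * x" for k x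
      by (simp add: mult.assoc[symmetric] power_mult_distrib[symmetric])
    ultimately show "expand_q ((- s) ^ card (inversions n w)) * c (- score_exponent n (inversions n w)) =
        expand_q (s ^ perm_length n w) * c (staircase n)"
      by (simp only: perm_length_eq_card_inversions[OF w])
  qed
  also have "\<dots> = expand_q (W0 n s) * c (staircase n)"
    by (simp add: W0_def sum_distrib_right)
  finally show ?thesis .
qed

section \<open>The bar involution as a ring homomorphism\<close>

lemma bar_zero: "bar 0 = 0"
  by (rule poly_mapping_eqI) (simp add: lookup_bar inj_homD(4)[OF inj_hom_bar_K])

lemma bar_add: "bar (f + g) = bar f + bar g"
  by (rule poly_mapping_eqI) (simp add: lookup_bar lookup_add inj_homD(2)[OF inj_hom_bar_K])

lemma bar_single: "bar (Poly_Mapping.single \<mu> a) = Poly_Mapping.single (- \<mu>) (bar_K a)"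
  by (rule poly_mapping_eqI)
    (auto simp: lookup_bar lookup_single when_def inj_homD(4)[OF inj_hom_bar_K])

lemma bar_uminus: "bar (- f) = - bar f"
  using bar_add[of f "- f"] by (simp add: bar_zero eq_neg_iff_add_eq_0 add.commute)

lemma bar_diff: "bar (f - g) = bar f - bar g"
  using bar_add[of f "- g"] by (simp add: bar_uminus)

lemma bar_mult: "bar (f * g) = bar f * bar g"
proof (induction f rule: lpoly_induct)
  case (single \<mu> a)
  show ?case
    by (induction g rule: lpoly_induct)
      (simp_all add: bar_zero bar_add bar_single distrib_left mult_single inj_homD(3)[OF inj_hom_bar_K])
qed (simp_all add: bar_zero bar_add distrib_right)

lemma bar_one: "bar 1 = 1"
  using bar_single[of 0 1] by (simp add: inj_homD(1)[OF inj_hom_bar_K])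

lemma bar_prod: "bar (prod f A) = (\<Prod>x\<in>A. bar (f x))"
  by (induction A rule: infinite_finite_induct) (simp_all add: bar_one bar_mult)

lemma permute_vars_bar:
  assumes w: "w permutes {1..n}"
  shows "permute_vars w (bar f) = bar (permute_vars w f)"
  by (rule poly_mapping_eqI)
    (simp add: lookup_bar lookup_permute_vars(1)[OF w] map_key_exponent_simps[OF w])


section \<open>Graded series\<close>

lemma lookup_single_mult:
  fixes f :: "'a::comm_ring_1 lpoly"
  shows "Poly_Mapping.lookup (Poly_Mapping.single \<nu> a * f) \<mu> = a * Poly_Mapping.lookup f (\<mu> - \<nu>)"
proof (induction f rule: lpoly_induct)
  case (single \<kappa> b)
  have "\<nu> + \<kappa> = \<mu> \<longleftrightarrow> \<kappa> = \<mu> - \<nu>" by (auto simp: algebra_simps)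
  then show ?case by (simp add: mult_single lookup_single when_def)
qed (simp_all add: distrib_left lookup_add)

section \<open>From graded series to coefficient functions\<close>

definition degree_coeff :: "graded_series \<Rightarrow> exponent \<Rightarrow> nat \<Rightarrow> nat \<Rightarrow> ratfun_s"
  where "degree_coeff Z \<mu> k d = coeff (Poly_Mapping.lookup (fps_nth Z d) \<mu>) k"

text \<open>\<open>Sum_any\<close> is 0 on an infinite support, so without this condition setting
  \<open>u = 1\<close> need not be additive.\<close>

definition locally_finite :: "graded_series \<Rightarrow> bool"
  where "locally_finite Z \<longleftrightarrow> (\<forall>\<mu> k. finite {d. degree_coeff Z \<mu> k d \<noteq> 0})"

text \<open>The specialization \<open>u = 1\<close>.\<close>

definition ungraded :: "graded_series \<Rightarrow> exponent \<Rightarrow> ratfun_s fls"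
  where "ungraded Z \<mu> = fps_to_fls (Abs_fps (\<lambda>k. Sum_any (degree_coeff Z \<mu> k)))"

lemma fls_nth_ungraded:
  "fls_nth (ungraded Z \<mu>) k = (if k < 0 then 0 else Sum_any (degree_coeff Z \<mu> (nat k)))"
  by (simp add: ungraded_def)

lemma inner_prod_eq_act: "inner_prod n a f g = act (f * bar g) (ungraded (J_series n a)) 0"
  by (simp add: inner_prod_def ct_def mult_series_def act_def J_coeff_def ungraded_def degree_coeff_def)

lemma q_divisible_ungraded: "q_divisible 0 (ungraded Z)"
  by (simp add: q_divisible_def fls_nth_ungraded)

text \<open>After \<open>u = 1\<close>, multiplication by \<open>P\<close> becomes the action of
  \<open>h\<close>. Quantifying over all \<open>Z\<close> and preserving local finiteness lets such
  statements be composed along products.\<close>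

definition represents :: "graded_series \<Rightarrow> ratfun_qs lpoly \<Rightarrow> bool"
  where "represents P h \<longleftrightarrow> (\<forall>Z. locally_finite Z \<longrightarrow>
    locally_finite (P * Z) \<and> ungraded (P * Z) = act h (ungraded Z))"

lemma represents_one: "represents 1 1"
  by (simp add: represents_def)

lemma represents_mult: "represents P f \<Longrightarrow> represents Q g \<Longrightarrow> represents (P * Q) (f * g)"
  by (simp add: represents_def mult.assoc act_mult)

lemma represents_power: "represents P f \<Longrightarrow> represents (P ^ k) (f ^ k)"
  by (induction k) (simp_all add: represents_one represents_mult)

lemma represents_prod:
  "(\<And>x. x \<in> A \<Longrightarrow> represents (P x) (f x)) \<Longrightarrow> represents (prod P A) (prod f A)"
  by (induction A rule: infinite_finite_induct) (simp_all add: represents_one represents_mult)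

lemma represents_diff:
  assumes "represents P f" "represents Q g"
  shows "represents (P - Q) (f - g)"
  unfolding represents_def
proof (intro allI impI conjI)
  fix Z assume "locally_finite Z"
  then have P: "locally_finite (P * Z)" "ungraded (P * Z) = act f (ungraded Z)"
    and Q: "locally_finite (Q * Z)" "ungraded (Q * Z) = act g (ungraded Z)"
    using assms by (auto simp: represents_def)
  have eq: "degree_coeff ((P - Q) * Z) \<mu> k d = degree_coeff (P * Z) \<mu> k d - degree_coeff (Q * Z) \<mu> k d" for \<mu> k d
    by (simp add: degree_coeff_def left_diff_distrib lookup_minus)
  let ?S = "\<lambda>\<mu> k. {d. degree_coeff (P * Z) \<mu> k d \<noteq> 0} \<union> {d. degree_coeff (Q * Z) \<mu> k d \<noteq> 0}"
  have fin: "finite (?S \<mu> k)" for \<mu> k using P(1) Q(1) by (simp add: locally_finite_def)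
  have sub: "{d. degree_coeff ((P - Q) * Z) \<mu> k d \<noteq> 0} \<subseteq> ?S \<mu> k" for \<mu> k by (auto simp: eq)
  show "locally_finite ((P - Q) * Z)"
    unfolding locally_finite_def using finite_subset[OF sub fin] by blast
  have "Sum_any (degree_coeff ((P - Q) * Z) \<mu> k) =
      Sum_any (degree_coeff (P * Z) \<mu> k) - Sum_any (degree_coeff (Q * Z) \<mu> k)" for \<mu> k
    unfolding Sum_any.expand_superset[OF fin sub]
    by (subst (1 2) Sum_any.expand_superset[OF fin[of \<mu> k]]) (auto simp: eq sum_subtractf)
  then have "ungraded ((P - Q) * Z) = (\<lambda>\<mu>. ungraded (P * Z) \<mu> - ungraded (Q * Z) \<mu>)"
    by (intro ext fls_eqI) (simp add: fls_nth_ungraded)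
  then show "ungraded ((P - Q) * Z) = act (f - g) (ungraded Z)"
    by (simp add: P Q act_diff)
qed

text \<open>A monomial only shifts the degree, the exponent and the power of \<open>q\<close>; the
  shift of the degree is forgotten at \<open>u = 1\<close>.\<close>

lemma represents_monom:
  "represents (fps_X ^ e * fps_const (Poly_Mapping.single \<nu> (monom a m)))
    (Poly_Mapping.single \<nu> (fract_const a * q_K ^ m))" (is "represents ?P _")
  unfolding represents_def
proof (intro allI impI conjI)
  fix Z assume Z: "locally_finite Z"
  have dc: "degree_coeff (?P * Z) \<mu> k d =
      (if d < e \<or> k < m then 0 else a * degree_coeff Z (\<mu> - \<nu>) (k - m) (d - e))" for \<mu> k d
  proof -
    have "fps_nth (?P * Z) d = (if d < e then 0 else Poly_Mapping.single \<nu> (monom a m) * fps_nth Z (d - e))"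
      by (simp add: mult.assoc fps_X_power_mult_nth)
    then show ?thesis by (simp add: degree_coeff_def lookup_single_mult coeff_monom_mult)
  qed
  let ?S = "\<lambda>\<mu> k. {d. degree_coeff Z (\<mu> - \<nu>) (k - m) d \<noteq> 0}"
  have fin: "finite ((+) e ` ?S \<mu> k)" for \<mu> k using Z by (simp add: locally_finite_def)
  have sub: "{d. degree_coeff (?P * Z) \<mu> k d \<noteq> 0} \<subseteq> (+) e ` ?S \<mu> k" for \<mu> k
  proof
    fix d assume "d \<in> {d. degree_coeff (?P * Z) \<mu> k d \<noteq> 0}"
    then show "d \<in> (+) e ` ?S \<mu> k"
      by (intro image_eqI[of _ _ "d - e"]) (auto simp: dc split: if_splits)
  qed
  show "locally_finite (?P * Z)"
    unfolding locally_finite_def using finite_subset[OF sub fin] by blast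
  have sum: "Sum_any (degree_coeff (?P * Z) \<mu> k) =
      (if k < m then 0 else a * Sum_any (degree_coeff Z (\<mu> - \<nu>) (k - m)))" for \<mu> k
    unfolding Sum_any.expand_superset[OF fin sub] Sum_any.expand_set[of "degree_coeff Z (\<mu> - \<nu>) (k - m)"]
    by (subst sum.reindex) (auto simp: dc sum_distrib_left)
  show "ungraded (?P * Z) = act (Poly_Mapping.single \<nu> (fract_const a * q_K ^ m)) (ungraded Z)"
  proof (rule ext)
    fix \<mu>
    have "Abs_fps (\<lambda>k. Sum_any (degree_coeff (?P * Z) \<mu> k)) =
        fps_X ^ m * (fps_const a * Abs_fps (\<lambda>k. Sum_any (degree_coeff Z (\<mu> - \<nu>) k)))"
      by (intro fps_ext) (simp add: sum fps_X_power_mult_nth)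
    then show "ungraded (?P * Z) \<mu> = act (Poly_Mapping.single \<nu> (fract_const a * q_K ^ m)) (ungraded Z) \<mu>"
      by (simp add: ungraded_def fls_times_fps_to_fls fps_to_fls_power expand_q_simps mult_ac)
  qed
qed

definition root_monom :: "nat \<Rightarrow> nat \<Rightarrow> ratfun_qs lpoly"
  where "root_monom i j = Poly_Mapping.single (Poly_Mapping.single i 1 - Poly_Mapping.single j 1) 1"

lemma fract_const_one: "fract_const (1::ratfun_s) = 1"
  by (rule inj_homD(1)[OF inj_hom_fract_const])

lemma monom_1_1: "[:0, 1:] = monom (1::'a::comm_semiring_1) 1"
  by (simp add: monom_Suc monom_0)

lemma monom_1_0: "monom (1::'a::comm_semiring_1) 0 = 1"
  by (simp add: monom_0 one_pCons)

lemma represents_pos_root: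
  assumes "1 \<le> i" "i \<le> j"
  shows "represents (pos_root n i j) (root_monom i j)"
  using represents_monom[of "j - i" _ 1 0]
  by (simp add: pos_root_eq[OF assms] root_monom_def fract_const_one monom_1_0)

lemma represents_q_S: "1 \<le> n \<Longrightarrow> represents (q_S n) (const q_K)"
  using represents_monom[of n 0 1 1]
  by (simp add: q_S_eq const_def fract_const_one monom_1_1)

lemma represents_t_S: "represents t_S (const t_K)"
  using represents_monom[of 0 0 t_F 0]
  by (simp add: t_S_def const_def t_K_def monom_0)

lemma represents_q_neg_root:
  assumes "1 \<le> i" "i < j" "j \<le> n"
  shows "represents (q_neg_root n i j) (const q_K * root_monom j i)"
  using represents_monom[of "n - (j - i)" _ 1 1]
  by (simp add: q_neg_root_eq[OF assms] root_monom_def const_def mult_single fract_const_one monom_1_1)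

section \<open>Homogeneity in the generators, and local finiteness\<close>

definition weight :: "exponent \<Rightarrow> int"
  where "weight \<nu> = Sum_any (\<lambda>i. int i * Poly_Mapping.lookup \<nu> i)"

lemma weight_eq_sum:
  assumes "finite A" "Poly_Mapping.keys \<nu> \<subseteq> A"
  shows "weight \<nu> = (\<Sum>i\<in>A. int i * Poly_Mapping.lookup \<nu> i)"
  unfolding weight_def using assms by (intro Sum_any.expand_superset) (auto simp: in_keys_iff)

lemma weight_add: "weight (\<mu> + \<nu>) = weight \<mu> + weight \<nu>"
proof -
  let ?A = "Poly_Mapping.keys \<mu> \<union> Poly_Mapping.keys \<nu>"
  have "Poly_Mapping.keys (\<mu> + \<nu>) \<subseteq> ?A" by (rule Poly_Mapping.keys_add)
  then show ?thesis
    by (simp add: weight_eq_sum[of ?A] lookup_add distrib_left sum.distrib)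
qed

lemma weight_zero: "weight 0 = 0"
  by (simp add: weight_def)

lemma weight_diff: "weight (\<mu> - \<nu>) = weight \<mu> - weight \<nu>"
  using weight_add[of "\<mu> - \<nu>" \<nu>] by simp

lemma weight_single: "weight (Poly_Mapping.single i a) = int i * a"
  using weight_eq_sum[of "{i}" "Poly_Mapping.single i a"] by (simp add: keys_single)

text \<open>
  Every generator \<open>gen n i\<close> is a monomial \<open>q\<^sup>k x\<^sup>\<mu>\<close> with \<open>n k - weight \<mu> = 1\<close>.
\<close>

inductive homogeneous :: "nat \<Rightarrow> int \<Rightarrow> ratfun_s poly lpoly \<Rightarrow> bool" for n d where
  zero: "homogeneous n d 0"
| monom: "d = int n * int m - weight \<nu> \<Longrightarrow> homogeneous n d (Poly_Mapping.single \<nu> (monom a m))"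
| add: "homogeneous n d f \<Longrightarrow> homogeneous n d g \<Longrightarrow> homogeneous n d (f + g)"

lemma homogeneous_uminus: "homogeneous n d f \<Longrightarrow> homogeneous n d (- f)"
proof (induction rule: homogeneous.induct)
  case (monom m \<nu> a)
  then show ?case using homogeneous.monom[of d n m \<nu> "- a"] by (simp add: minus_monom[symmetric] single_uminus)
next
  case (add f g)
  then show ?case unfolding minus_add_distrib by (intro homogeneous.add)
qed (simp add: homogeneous.zero)

lemma homogeneous_sum: "(\<And>x. x \<in> A \<Longrightarrow> homogeneous n d (f x)) \<Longrightarrow> homogeneous n d (sum f A)"
  by (induction A rule: infinite_finite_induct) (auto intro: homogeneous.intros)

lemma homogeneous_mult:
  assumes "homogeneous n d f" "homogeneous n e g"
  shows "homogeneous n (d + e) (f * g)"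
  using assms(1)
proof induction
  case (monom m \<nu> a)
  note outer = this
  show ?case
    using assms(2)
  proof induction
    case (monom k \<kappa> b)
    then show ?case
      unfolding mult_single mult_monom
      by (intro homogeneous.monom) (simp add: outer weight_add algebra_simps)
  qed (auto intro: homogeneous.intros simp: distrib_left)
qed (auto intro: homogeneous.intros simp: distrib_right)

lemma homogeneous_coeff:
  "homogeneous n d f \<Longrightarrow> coeff (Poly_Mapping.lookup f \<mu>) k \<noteq> 0 \<Longrightarrow> d = int n * int k - weight \<mu>"
proof (induction rule: homogeneous.induct)
  case (add f g)
  then show ?case by (cases "coeff (Poly_Mapping.lookup f \<mu>) k = 0") (auto simp: lookup_add)
qed (auto simp: lookup_single when_def split: if_splits)

definition homogeneous_series :: "nat \<Rightarrow> graded_series \<Rightarrow> bool"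
  where "homogeneous_series n Z \<longleftrightarrow> (\<forall>d. homogeneous n (int d) (fps_nth Z d))"

lemma homogeneous_series_monom:
  assumes "int e = int n * int m - weight \<nu>"
  shows "homogeneous_series n (fps_X ^ e * fps_const (Poly_Mapping.single \<nu> (monom a m)))"
  using assms
  by (auto simp: homogeneous_series_def fps_X_power_mult_nth intro: homogeneous.zero homogeneous.monom)

lemma homogeneous_series_one: "homogeneous_series n 1"
  using homogeneous_series_monom[of 0 n 0 0 1] by (simp add: weight_zero monom_1_0)

lemma homogeneous_series_diff:
  "homogeneous_series n Y \<Longrightarrow> homogeneous_series n Z \<Longrightarrow> homogeneous_series n (Y - Z)"
  unfolding homogeneous_series_def diff_conv_add_uminus fps_add_nth fps_neg_nth
  by (blast intro: homogeneous.add homogeneous_uminus)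

lemma homogeneous_series_mult:
  assumes "homogeneous_series n Y" "homogeneous_series n Z"
  shows "homogeneous_series n (Y * Z)"
  unfolding homogeneous_series_def fps_mult_nth
proof (intro allI homogeneous_sum)
  fix d i :: nat assume "i \<in> {0..d}"
  have "homogeneous n (int i + int (d - i)) (fps_nth Y i * fps_nth Z (d - i))"
    using assms by (intro homogeneous_mult) (auto simp only: homogeneous_series_def)
  then show "homogeneous n (int d) (fps_nth Y i * fps_nth Z (d - i))"
    using \<open>i \<in> {0..d}\<close> by (simp add: of_nat_diff)
qed

lemma homogeneous_series_prod:
  "(\<And>x. x \<in> A \<Longrightarrow> homogeneous_series n (f x)) \<Longrightarrow> homogeneous_series n (prod f A)"
  by (induction A rule: infinite_finite_induct) (simp_all add: homogeneous_series_one homogeneous_series_mult)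

lemma homogeneous_series_power: "homogeneous_series n Z \<Longrightarrow> homogeneous_series n (Z ^ k)"
  by (induction k) (simp_all add: homogeneous_series_one homogeneous_series_mult)

lemma inv_series_right: "fps_nth Z 0 = 1 \<Longrightarrow> Z * inv_series Z = 1"
  unfolding inv_series_def by (rule fps_right_inverse) simp

text \<open>Comparing coefficients in \<open>Z * inv_series Z = 1\<close> expresses each coefficient
  of the inverse by earlier ones, with degrees adding up to \<open>d\<close> in every
  summand.\<close>

lemma homogeneous_series_inv_series:
  assumes "homogeneous_series n Z" "fps_nth Z 0 = 1"
  shows "homogeneous_series n (inv_series Z)"
proof -
  have "homogeneous n (int d) (fps_nth (inv_series Z) d)" for d
  proof (induction d rule: less_induct)
    case (less d)
    have "fps_nth 1 d = (\<Sum>i\<in>{0..d}. fps_nth Z i * fps_nth (inv_series Z) (d - i))"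
      unfolding inv_series_right[OF assms(2), symmetric] by (rule fps_mult_nth)
    also have "\<dots> = fps_nth (inv_series Z) d + (\<Sum>i\<in>{0<..d}. fps_nth Z i * fps_nth (inv_series Z) (d - i))"
      by (simp add: sum.head assms(2))
    finally have "fps_nth (inv_series Z) d =
        fps_nth 1 d + - (\<Sum>i\<in>{0<..d}. fps_nth Z i * fps_nth (inv_series Z) (d - i))"
      by (simp add: algebra_simps)
    also have "homogeneous n (int d) \<dots>"
    proof (intro homogeneous.add homogeneous_uminus homogeneous_sum)
      show "homogeneous n (int d) (fps_nth 1 d)"
        using homogeneous_series_one by (simp add: homogeneous_series_def)
      fix i assume i: "i \<in> {0<..d}"
      have "homogeneous n (int i + int (d - i)) (fps_nth Z i * fps_nth (inv_series Z) (d - i))"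
        using assms(1) i by (intro homogeneous_mult less) (auto simp: homogeneous_series_def)
      then show "homogeneous n (int d) (fps_nth Z i * fps_nth (inv_series Z) (d - i))"
        using i by (simp add: of_nat_diff)
    qed
    finally show ?case .
  qed
  then show ?thesis by (simp add: homogeneous_series_def)
qed

text \<open>The power of \<open>q\<close> and the exponent leave a single degree in which a nonzero
  coefficient can occur.\<close>

lemma homogeneous_series_locally_finite:
  assumes "homogeneous_series n Z"
  shows "locally_finite Z"
  unfolding locally_finite_def
proof (intro allI)
  fix \<mu> k
  have "{d. degree_coeff Z \<mu> k d \<noteq> 0} \<subseteq> {nat (int n * int k - weight \<mu>)}"
  proof
    fix d assume "d \<in> {d. degree_coeff Z \<mu> k d \<noteq> 0}"
    then have "int d = int n * int k - weight \<mu>"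
      using assms by (auto simp: homogeneous_series_def degree_coeff_def intro: homogeneous_coeff)
    then show "d \<in> {nat (int n * int k - weight \<mu>)}" by simp
  qed
  then show "finite {d. degree_coeff Z \<mu> k d \<noteq> 0}" by (rule finite_subset) simp
qed

lemma homogeneous_series_pos_root:
  assumes "1 \<le> i" "i \<le> j"
  shows "homogeneous_series n (pos_root n i j)"
  using homogeneous_series_monom[of "j - i" n 0 "Poly_Mapping.single i 1 - Poly_Mapping.single j 1" 1] assms
  by (simp add: pos_root_eq[OF assms] weight_diff weight_single of_nat_diff monom_1_0)

lemma homogeneous_series_q_S: "1 \<le> n \<Longrightarrow> homogeneous_series n (q_S n)"
  using homogeneous_series_monom[of n n 1 0 1]
  by (simp add: q_S_eq const_def weight_zero monom_1_1)

lemma homogeneous_series_t_S: "homogeneous_series n t_S"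
  using homogeneous_series_monom[of 0 n 0 0 t_F]
  by (simp add: t_S_def const_def weight_zero monom_0)

lemma homogeneous_series_q_neg_root:
  assumes "1 \<le> i" "i < j" "j \<le> n"
  shows "homogeneous_series n (q_neg_root n i j)"
  using homogeneous_series_monom[of "n - (j - i)" n 1 "Poly_Mapping.single j 1 - Poly_Mapping.single i 1" 1] assms
  by (simp add: q_neg_root_eq[OF assms] weight_diff weight_single of_nat_diff monom_1_1)

section \<open>Infinite q-Pochhammer products\<close>

context
  fixes n :: nat
  assumes n: "1 \<le> n"
begin

lemma q_S_power_mult_nth_eq_0:
  assumes "k < n * r"
  shows "fps_nth (q_S n ^ r * Z) k = 0"
proof -
  have "q_S n ^ r * Z = fps_X ^ (n * r) * (fps_const (const [:0, 1:]) ^ r * Z)"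
    by (simp add: q_S_eq[OF n] power_mult_distrib power_mult mult.assoc)
  then show ?thesis using assms by (simp only: fps_X_power_mult_nth if_True)
qed

context
  fixes z :: graded_series
  assumes z: "fps_nth z 0 = 0"
begin

text \<open>The factor with index \<open>N\<close> differs from 1 by a series of order at least
  \<open>n * N + 1\<close> in \<open>u\<close>, so it does not affect coefficients up to degree
  \<open>N\<close>.\<close>

lemma q_poch_partial_nth:
  "d \<le> N \<Longrightarrow> fps_nth (\<Prod>r<N. 1 - q_S n ^ r * z) d = fps_nth (\<Prod>r<d. 1 - q_S n ^ r * z) d"
proof (induction N rule: dec_induct)
  case (step N)
  have "z = fps_X * fps_shift 1 z"
    using z by (intro fps_ext) (auto simp: fps_X_mult_nth)
  let ?p = "\<Prod>r<N. 1 - q_S n ^ r * z"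
  have "(\<Prod>r<Suc N. 1 - q_S n ^ r * z) = ?p - z * (q_S n ^ N * ?p)"
    by (simp add: algebra_simps)
  also have "z * (q_S n ^ N * ?p) = fps_X * fps_shift 1 z * (q_S n ^ N * ?p)"
    using \<open>z = _\<close> by (rule arg_cong)
  also have "\<dots> = fps_X * (q_S n ^ N * (fps_shift 1 z * ?p))"
    by (simp only: mult_ac)
  finally have "(\<Prod>r<Suc N. 1 - q_S n ^ r * z) = ?p - fps_X * (q_S n ^ N * (fps_shift 1 z * ?p))" .
  moreover have "fps_nth (fps_X * (q_S n ^ N * (fps_shift 1 z * ?p))) d = 0"
  proof (cases d)
    case (Suc k)
    then have "k < n * N" using step(1) n by (metis Suc_le_lessD less_le_trans mult_le_mono1 mult_1)
    then show ?thesis using Suc q_S_power_mult_nth_eq_0 by simp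
  qed simp
  ultimately show ?case using step by simp
qed simp

lemma q_poch_nth: "d \<le> N \<Longrightarrow> fps_nth (q_poch n z) d = fps_nth (\<Prod>r<N. 1 - q_S n ^ r * z) d"
proof -
  define L where "L = Abs_fps (\<lambda>d. fps_nth (\<Prod>r<d. 1 - q_S n ^ r * z) d)"
  have "(\<lambda>N. \<Prod>r\<le>N. 1 - q_S n ^ r * z) \<longlonglongrightarrow> L"
  proof (rule tendsto_fpsI)
    fix d
    show "\<forall>\<^sub>F N in sequentially. fps_nth (\<Prod>r\<le>N. 1 - q_S n ^ r * z) d = fps_nth L d"
      using eventually_ge_at_top[of d]
    proof eventually_elim
      case (elim N)
      then show ?case
        using q_poch_partial_nth[of d "Suc N"] by (simp add: L_def lessThan_Suc_atMost)
    qed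
  qed
  \<comment> \<open>Convergence in the sense of \<open>has_prod\<close> demands a nonzero limit;
    here the constant term is 1.\<close>
  moreover have "L \<noteq> 0"
  proof
    assume "L = 0"
    then have "fps_nth L 0 = 0" by simp
    then show False by (simp add: L_def)
  qed
  ultimately have "(\<lambda>r. 1 - q_S n ^ r * z) has_prod L"
    by (simp add: has_prod_def raw_has_prod_def)
  then have "q_poch n z = L"
    unfolding q_poch_def by (rule has_prod_unique[symmetric])
  then show "d \<le> N \<Longrightarrow> fps_nth (q_poch n z) d = fps_nth (\<Prod>r<N. 1 - q_S n ^ r * z) d"
    using q_poch_partial_nth[of d N] by (simp add: L_def)
qed

lemma q_poch_nth_0: "fps_nth (q_poch n z) 0 = 1"
  using q_poch_nth[of 0 0] by simp

lemma homogeneous_series_q_poch: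
  assumes "homogeneous_series n z"
  shows "homogeneous_series n (q_poch n z)"
proof -
  have "homogeneous_series n (\<Prod>r<d. 1 - q_S n ^ r * z)" for d
    using assms n by (intro homogeneous_series_prod homogeneous_series_diff homogeneous_series_one
        homogeneous_series_mult homogeneous_series_power homogeneous_series_q_S)
  then show ?thesis unfolding homogeneous_series_def using q_poch_nth[OF order_refl] by metis
qed

end

lemma q_poch_split:
  assumes z: "fps_nth z 0 = 0"
  shows "q_poch n z = (\<Prod>r<m. 1 - q_S n ^ r * z) * q_poch n (q_S n ^ m * z)"
proof (rule fps_ext)
  fix d
  have z': "fps_nth (q_S n ^ m * z) 0 = 0" using z by simp
  have split: "(\<Prod>r<m + d. 1 - q_S n ^ r * z) =
      (\<Prod>r<m. 1 - q_S n ^ r * z) * (\<Prod>r<d. 1 - q_S n ^ r * (q_S n ^ m * z))"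
    by (induction d) (simp_all add: power_add mult_ac)
  have "fps_nth ((\<Prod>r<m. 1 - q_S n ^ r * z) * q_poch n (q_S n ^ m * z)) d =
      fps_nth ((\<Prod>r<m. 1 - q_S n ^ r * z) * (\<Prod>r<d. 1 - q_S n ^ r * (q_S n ^ m * z))) d"
    unfolding fps_mult_nth by (intro sum.cong refl) (simp add: q_poch_nth[OF z', of _ d])
  also have "\<dots> = fps_nth (q_poch n z) d"
    unfolding split[symmetric] by (rule q_poch_nth[OF z, symmetric]) simp
  finally show "fps_nth (q_poch n z) d =
      fps_nth ((\<Prod>r<m. 1 - q_S n ^ r * z) * q_poch n (q_S n ^ m * z)) d" ..
qed

lemma inv_series_q_poch_split:
  assumes z: "fps_nth z 0 = 0"
  shows "(\<Prod>r<m. 1 - q_S n ^ r * z) * inv_series (q_poch n z) = inv_series (q_poch n (q_S n ^ m * z))"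
proof -
  let ?A = "\<Prod>r<m. 1 - q_S n ^ r * z" and ?B = "q_poch n (q_S n ^ m * z)"
  have B: "?B * inv_series ?B = 1"
    using z by (intro inv_series_right q_poch_nth_0) simp
  have "?A * inv_series (q_poch n z) = ?A * inv_series (q_poch n z) * (?B * inv_series ?B)"
    by (simp add: B)
  also have "\<dots> = (?A * ?B) * inv_series (q_poch n z) * inv_series ?B"
    by (simp only: mult_ac)
  also have "?A * ?B * inv_series (q_poch n z) = 1"
    unfolding q_poch_split[OF z, of m, symmetric] by (rule inv_series_right[OF q_poch_nth_0[OF z]])
  finally show ?thesis by simp
qed

end

section \<open>Congruences between graded series\<close>

lemma fps_const_dvd_iff:
  fixes Z :: "'a::comm_ring_1 fps"
  shows "fps_const c dvd Z \<longleftrightarrow> (\<forall>d. c dvd fps_nth Z d)"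
proof
  assume "\<forall>d. c dvd fps_nth Z d"
  then obtain f where "fps_nth Z d = c * f d" for d unfolding dvd_def by metis
  then have "Z = fps_const c * Abs_fps f" by (intro fps_ext) simp
  then show "fps_const c dvd Z" by simp
qed auto

lemma dvd_mult_minus_one:
  fixes a b c :: "'a::comm_ring_1"
  assumes "c dvd a - 1" "c dvd b - 1"
  shows "c dvd a * b - 1"
proof -
  have "a * b - 1 = (a - 1) * b + (b - 1)" by (simp add: algebra_simps)
  then show ?thesis using assms by (metis dvd_add dvd_mult2)
qed

lemma dvd_prod_minus_one:
  fixes f :: "'b \<Rightarrow> 'a::comm_ring_1"
  assumes "\<And>x. x \<in> A \<Longrightarrow> c dvd f x - 1"
  shows "c dvd prod f A - 1"
  using assms by (induction A rule: infinite_finite_induct) (simp_all add: dvd_mult_minus_one)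

lemma dvd_inv_series_minus_one:
  assumes "c dvd Z - 1" "fps_nth Z 0 = 1"
  shows "c dvd inv_series Z - 1"
proof -
  have "inv_series Z - 1 = - ((Z - 1) * inv_series Z)"
    using inv_series_right[OF assms(2)] by (simp add: algebra_simps)
  then show ?thesis using assms(1) by simp
qed

lemma dvd_q_poch_minus_one:
  assumes n: "1 \<le> n" and z: "fps_nth z 0 = 0" and "fps_const c dvd z"
  shows "fps_const c dvd q_poch n z - 1"
  unfolding fps_const_dvd_iff
proof
  fix d
  have "fps_const c dvd (\<Prod>r<d. 1 - q_S n ^ r * z) - 1"
    using assms(3) by (intro dvd_prod_minus_one) simp
  then show "c dvd fps_nth (q_poch n z - 1) d"
    unfolding fps_const_dvd_iff by (simp add: q_poch_nth[OF n z order_refl])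
qed

lemma ungraded_one: "ungraded 1 = delta"
proof (rule ext, rule fls_eqI)
  fix \<mu> k
  have "degree_coeff 1 \<mu> (nat k) d = (if d = 0 then (if \<mu> = 0 \<and> nat k = 0 then 1 else 0) else 0)" for d
    by (auto simp: degree_coeff_def lookup_one when_def)
  then show "fls_nth (ungraded 1 \<mu>) k = fls_nth (delta \<mu>) k"
    by (auto simp: fls_nth_ungraded delta_def)
qed

text \<open>Below \<open>q ^ m\<close> the coefficients of \<open>Z\<close> and of 1 agree degree by
  degree, hence also after summation over the degrees.\<close>

lemma q_divisible_ungraded_minus_delta:
  assumes "fps_const (const [:0, 1:] ^ m) dvd Z - 1"
  shows "q_divisible m (\<lambda>\<mu>. ungraded Z \<mu> - delta \<mu>)"
  unfolding q_divisible_def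
proof (intro allI impI)
  fix \<mu> and k :: int assume k: "k < int m"
  have "const [:0, 1:] ^ m = (Poly_Mapping.single 0 (monom 1 m) :: ratfun_s poly lpoly)"
  proof (induction m)
    case 0 then show ?case by (simp add: monom_1_0)
  next
    case (Suc m)
    then show ?case by (simp add: const_def mult_single monom_1_1 mult_monom)
  qed
  then obtain W where "Z = 1 + fps_const (Poly_Mapping.single 0 (monom 1 m)) * W"
    using assms by (metis add_diff_cancel_left' diff_add_cancel dvd_def add.commute)
  then have "degree_coeff Z \<mu> (nat k) d = degree_coeff 1 \<mu> (nat k) d" if "k \<ge> 0" for d
    using k that by (simp add: degree_coeff_def lookup_add lookup_single_mult coeff_monom_mult)
  then show "fls_nth (ungraded Z \<mu> - delta \<mu>) k = 0"
    unfolding ungraded_one[symmetric] by (cases "k < 0") (simp_all add: fls_nth_ungraded cong: Sum_any.cong)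
qed


section \<open>The two inner products\<close>

lemma W0_hom:
  assumes "inj_hom h"
  shows "h (W0 n a) = W0 n (h a)"
proof -
  note H = inj_homD[OF assms]
  have pow: "h (a ^ k) = h a ^ k" for k by (induction k) (simp_all add: H)
  have "h (sum f A) = (\<Sum>x\<in>A. h (f x))" for f :: "(nat \<Rightarrow> nat) \<Rightarrow> _" and A
    by (induction A rule: infinite_finite_induct) (simp_all add: H)
  then show ?thesis by (simp add: W0_def pow)
qed

text \<open>As a polynomial in \<open>t^(1/2)\<close>, \<open>W0 n t\<close> takes the value
  \<open>n!\<close> at 1. Nonvanishing then passes through the injective embeddings and through
  \<open>bar_K\<close>, which inverts \<open>t_K\<close>.\<close>

lemma W0_inverse_t_K_nonzero: "W0 n (inverse t_K) \<noteq> 0"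
proof -
  have h: "inj_hom (\<lambda>p::complex poly. Fraction_Field.Fract p 1)"
    by (auto simp: inj_hom_def One_fract_def Zero_fract_def eq_fract)
  have t: "t_F = Fraction_Field.Fract ([:0, 1:] ^ 2) 1"
    by (simp add: t_F_def s_F_def fract_var_def power2_eq_square)
  have "poly (W0 n ([:0, 1:] ^ 2)) 1 = (\<Sum>w | w permutes {1..n}. (1::complex))"
    by (simp add: W0_def poly_sum)
  also have "\<dots> \<noteq> 0" by (simp add: card_permutations[OF refl])
  finally have "W0 n ([:0, 1:] ^ 2 :: complex poly) \<noteq> 0" by auto
  then have "W0 n t_F \<noteq> 0"
    unfolding t W0_hom[OF h, symmetric] inj_homD(5)[OF h] .
  then have "W0 n t_K \<noteq> 0"
    unfolding t_K_def W0_hom[OF inj_hom_fract_const, symmetric] inj_homD(5)[OF inj_hom_fract_const] .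
  then show ?thesis
    unfolding bar_K_simps(3)[symmetric] W0_hom[OF inj_hom_bar_K, symmetric] inj_homD(5)[OF inj_hom_bar_K] .
qed

text \<open>No negative powers of \<open>q\<close> occur, so acting by such a polynomial preserves
  divisibility by each power of \<open>q\<close>.\<close>

definition integral_lpoly :: "ratfun_qs lpoly \<Rightarrow> bool"
  where "integral_lpoly h \<longleftrightarrow> q_divisible 0 (act h delta)"

lemma integral_lpoly_one: "integral_lpoly 1"
  by (simp add: integral_lpoly_def q_divisible_def delta_def)

lemma integral_lpoly_mult:
  "integral_lpoly f \<Longrightarrow> integral_lpoly g \<Longrightarrow> integral_lpoly (f * g)"
  unfolding integral_lpoly_def act_mult using q_divisible_act[of 0 f 0] by simp

lemma integral_lpoly_diff:
  "integral_lpoly f \<Longrightarrow> integral_lpoly g \<Longrightarrow> integral_lpoly (f - g)"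
  unfolding integral_lpoly_def act_diff by (rule q_divisible_diff)

lemma integral_lpoly_prod:
  "(\<And>x. x \<in> A \<Longrightarrow> integral_lpoly (f x)) \<Longrightarrow> integral_lpoly (prod f A)"
  by (induction A rule: infinite_finite_induct) (simp_all add: integral_lpoly_one integral_lpoly_mult)

lemma integral_lpoly_single_1: "integral_lpoly (Poly_Mapping.single \<mu> 1)"
  by (simp add: integral_lpoly_def q_divisible_def delta_def)

lemma integral_lpoly_uminus_one_power: "integral_lpoly (const ((-1) ^ k))"
proof -
  have "const ((-1) ^ k) = (-1 :: ratfun_qs lpoly) ^ k"
    by (induction k) (simp_all add: const_def mult_single single_uminus flip: mult_minus_left)
  moreover have m1: "integral_lpoly (-1)"
    using integral_lpoly_diff[OF integral_lpoly_diff[OF integral_lpoly_one integral_lpoly_one] integral_lpoly_one]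
    by simp
  moreover have "integral_lpoly ((-1) ^ k)"
    by (induction k) (simp_all only: power_0 power_Suc integral_lpoly_one integral_lpoly_mult m1)
  ultimately show ?thesis by simp
qed

lemma q_divisible_minus_one_mult:
  assumes "q_divisible 1 (act (f - 1) delta)" "integral_lpoly g" "q_divisible 1 (act (g - 1) delta)"
  shows "q_divisible 1 (act (f * g - 1) delta)"
proof -
  have "f * g - 1 = (f - 1) * g + (g - 1)" by (simp add: algebra_simps)
  then have "act (f * g - 1) delta = (\<lambda>\<mu>. act ((f - 1) * g) delta \<mu> + act (g - 1) delta \<mu>)"
    by (metis act_add)
  moreover have "q_divisible 1 (act ((f - 1) * g) delta)"
    using q_divisible_act[OF assms(1), of 0 "act g delta"] assms(2) by (simp add: integral_lpoly_def act_mult)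
  ultimately show ?thesis
    using assms(3) by (simp add: q_divisible_def)
qed

lemma q_divisible_minus_one_imp_integral:
  assumes "q_divisible 1 (act (f - 1) delta)"
  shows "integral_lpoly f"
proof -
  have "q_divisible 0 (act (f - 1) delta)" using assms by (auto simp: q_divisible_def)
  then have "integral_lpoly (f - 1)" by (simp add: integral_lpoly_def)
  \<comment> \<open>Here \<open>f\<close> is written as \<open>(f - 1) - ((1 - 1) - 1)\<close>,
    using differences only.\<close>
  from integral_lpoly_diff[OF this integral_lpoly_diff[OF integral_lpoly_diff[OF
    integral_lpoly_one integral_lpoly_one] integral_lpoly_one]]
  show ?thesis by simp
qed

lemma q_divisible_minus_one_prod:
  assumes "\<And>x. x \<in> A \<Longrightarrow> q_divisible 1 (act (f x - 1) delta)"
  shows "q_divisible 1 (act (prod f A - 1) delta)"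
  using assms
proof (induction A rule: infinite_finite_induct)
  case (insert x A)
  then have "q_divisible 1 (act (f x - 1) delta)" "q_divisible 1 (act (prod f A - 1) delta)"
    by blast+
  then show ?case
    unfolding prod.insert[OF insert.hyps]
    by (intro q_divisible_minus_one_mult q_divisible_minus_one_imp_integral)
qed (simp_all add: q_divisible_def)

lemma const_mult: "const (a * b) = (const a * const b :: 'a::semiring_0 lpoly)"
  by (simp add: const_def mult_single)

lemma const_power: "const (a ^ k) = (const a ^ k :: 'a::comm_ring_1 lpoly)"
  by (induction k) (simp_all add: const_mult, simp add: const_def)

lemma const_one: "const 1 = (1 :: 'a::comm_ring_1 lpoly)"
  by (simp add: const_def)

text \<open>
  For \<open>a = t_K\<close> resp. \<open>a = 1\<close>, the product \<open>lead_factor n a * symmetric_factor n a M\<close> agrees modulo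
  a power of \<open>q\<close> with the denominator resp. the numerator of the weight function.
\<close>

definition lead_factor :: "nat \<Rightarrow> ratfun_qs \<Rightarrow> ratfun_qs lpoly"
  where "lead_factor n a = (\<Prod>(i, j)\<in>pairs n. 1 - const a * root_monom i j)"

definition symmetric_factor :: "nat \<Rightarrow> ratfun_qs \<Rightarrow> nat \<Rightarrow> ratfun_qs lpoly"
  where "symmetric_factor n a M = (\<Prod>(i, j)\<in>pairs n. \<Prod>r<M.
    (1 - const (q_K ^ Suc r * a) * root_monom i j) * (1 - const (q_K ^ Suc r * a) * root_monom j i))"

lemma permute_vars_root_monom:
  assumes w: "w permutes {1..n}"
  shows "permute_vars w (root_monom i j) = root_monom (w i) (w j)"
proof -
  have "Poly_Mapping.map_key (inv w) (Poly_Mapping.single k 1) = (Poly_Mapping.single (w k) 1 :: exponent)" for k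
    using map_key_single[OF permutes_inj[OF permutes_inv[OF w]], of "w k"] permutes_inverses(2)[OF w] by simp
  then show ?thesis
    by (simp add: root_monom_def permute_vars_single[OF w] map_key_exponent_simps[OF permutes_inv[OF w]])
qed

lemma permute_vars_symmetric_factor:
  assumes w: "w permutes {1..n}"
  shows "permute_vars w (symmetric_factor n a M) = symmetric_factor n a M"
proof -
  define F where "F i j = (\<Prod>r<M. (1 - const (q_K ^ Suc r * a) * root_monom i j) *
    (1 - const (q_K ^ Suc r * a) * root_monom j i))" for i j
  have "permute_vars w (symmetric_factor n a M) = (\<Prod>(i, j)\<in>pairs n. F (w i) (w j))"
    unfolding symmetric_factor_def F_def
    by (simp only: permute_vars_prod[OF w] case_prod_unfold permute_vars_mult[OF w] permute_vars_diff[OF w]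
        permute_vars_one[OF w] permute_vars_const[OF w] permute_vars_root_monom[OF w])
  also have "\<dots> = (\<Prod>(i, j)\<in>pairs n. F i j)"
    by (rule prod_pairs_permutes[OF w]) (simp add: F_def mult.commute)
  finally show ?thesis by (simp add: symmetric_factor_def F_def)
qed

text \<open>The powers of \<open>q\<close> in the factors start at 1 and \<open>a\<close> is free of
  \<open>q\<close>, so each factor is 1 modulo \<open>q\<close>.\<close>

lemma q_divisible_symmetric_factor:
  assumes a: "expand_q a = fls_const c"
  shows "q_divisible 1 (act (symmetric_factor n a M - 1) delta)"
proof -
  have factor: "q_divisible 1 (act (1 - const (q_K ^ Suc r * a) * root_monom i j - 1) delta)" for r i j
  proof -
    have "1 - const (q_K ^ Suc r * a) * root_monom i j - 1 =
        - Poly_Mapping.single (Poly_Mapping.single i 1 - Poly_Mapping.single j 1) (q_K ^ Suc r * a)"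
      by (simp add: const_def root_monom_def mult_single)
    moreover have "fls_nth (fls_X ^ Suc r * fls_const c * delta \<mu>) k = 0" if "k < 1" for \<mu> k
      using that by (simp add: delta_def fls_X_power_times_conv_shift del: power_Suc)
    ultimately show ?thesis
      by (simp add: act_uminus q_divisible_def expand_q_simps a del: power_Suc)
  qed
  show ?thesis
    unfolding symmetric_factor_def case_prod_unfold
    by (intro q_divisible_minus_one_prod q_divisible_minus_one_mult factor
        q_divisible_minus_one_imp_integral)
qed

lemma integral_lpoly_symmetric_factor:
  "expand_q a = fls_const c \<Longrightarrow> integral_lpoly (symmetric_factor n a M)"
  by (rule q_divisible_minus_one_imp_integral[OF q_divisible_symmetric_factor])

lemma expand_q_t_K: "expand_q t_K = fls_const t_F"
  by (simp add: t_K_def expand_q_simps)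

section \<open>Truncation of the weight function\<close>

context
  fixes n :: nat
  assumes n: "1 \<le> n"
begin

text \<open>\<open>q_neg_root\<close> already contains one power of \<open>q\<close>. With
  \<open>Suc M\<close> factors for \<open>x\<^sub>i / x\<^sub>j\<close>, splitting off the one with
  \<open>r = 0\<close> leaves the powers \<open>q, ..., q ^ M\<close> for both roots, and so a
  symmetric product.\<close>

definition graded_factor :: "graded_series \<Rightarrow> nat \<Rightarrow> graded_series"
  where "graded_factor s M = (\<Prod>(i, j)\<in>pairs n.
    (\<Prod>r<Suc M. 1 - q_S n ^ r * (s * pos_root n i j)) * (\<Prod>r<M. 1 - q_S n ^ r * (s * q_neg_root n i j)))"

lemma represents_graded_factor:
  assumes s: "represents s (const a)"
  shows "represents (graded_factor s M) (lead_factor n a * symmetric_factor n a M)"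
proof -
  have "represents (graded_factor s M) (\<Prod>(i, j)\<in>pairs n.
    (\<Prod>r<Suc M. 1 - const q_K ^ r * (const a * root_monom i j)) *
    (\<Prod>r<M. 1 - const q_K ^ r * (const a * (const q_K * root_monom j i))))"
    unfolding graded_factor_def case_prod_beta
    by (intro represents_prod represents_mult represents_diff represents_one represents_power s
        represents_q_S[OF n] represents_pos_root represents_q_neg_root) (auto simp: pairs_def)
  also have "(\<Prod>(i, j)\<in>pairs n.
    (\<Prod>r<Suc M. 1 - const q_K ^ r * (const a * root_monom i j)) *
    (\<Prod>r<M. 1 - const q_K ^ r * (const a * (const q_K * root_monom j i)))) =
    lead_factor n a * symmetric_factor n a M"
    unfolding lead_factor_def symmetric_factor_def prod.distrib[symmetric]
    by (intro prod.cong refl)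
      (simp add: case_prod_beta prod.lessThan_Suc_shift prod.distrib const_mult const_power mult_ac del: prod.lessThan_Suc)
  finally show ?thesis .
qed

lemma pos_root_nth_0: "(i, j) \<in> pairs n \<Longrightarrow> fps_nth (pos_root n i j) 0 = 0"
  by (simp add: pairs_def pos_root_eq fps_X_power_mult_nth)

lemma q_neg_root_nth_0: "(i, j) \<in> pairs n \<Longrightarrow> fps_nth (q_neg_root n i j) 0 = 0"
  by (auto simp add: pairs_def q_neg_root_eq fps_X_power_mult_nth)

text \<open>What remains of the weight once the truncated products are split off. Every argument
  contains \<open>q ^ M\<close>, so the whole is 1 modulo \<open>q ^ M\<close>.\<close>

definition q_tail :: "nat \<Rightarrow> graded_series"
  where "q_tail M = (\<Prod>(i, j)\<in>pairs n.
     q_poch n (q_S n ^ Suc M * pos_root n i j) * inv_series (q_poch n (q_S n ^ Suc M * (t_S * pos_root n i j))) *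
     (q_poch n (q_S n ^ M * q_neg_root n i j) * inv_series (q_poch n (q_S n ^ M * (t_S * q_neg_root n i j)))))"

text \<open>The truncated denominators turn each inverse Pochhammer product into the inverse of its
  tail, while the numerators split into truncation and tail.\<close>

lemma graded_factor_J_series: "graded_factor t_S M * J_series n t_S = graded_factor 1 M * q_tail M"
  unfolding graded_factor_def J_series_def q_tail_def prod.distrib[symmetric]
proof (intro prod.cong refl, clarify)
  fix i j assume ij: "(i, j) \<in> pairs n"
  let ?p = "pos_root n i j" and ?m = "q_neg_root n i j"
  have p: "fps_nth ?p 0 = 0" "fps_nth (t_S * ?p) 0 = 0" and m: "fps_nth ?m 0 = 0" "fps_nth (t_S * ?m) 0 = 0"
    by (simp_all add: pos_root_nth_0[OF ij] q_neg_root_nth_0[OF ij])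
  have rearrange: "(a * b) * (c * d * (e * f)) = c * (a * d) * (e * (b * f))" for a b c d e f :: graded_series
    by (simp only: mult_ac)
  show "(\<Prod>r<Suc M. 1 - q_S n ^ r * (t_S * ?p)) * (\<Prod>r<M. 1 - q_S n ^ r * (t_S * ?m)) *
      (q_poch n ?p * inv_series (q_poch n (t_S * ?p)) * (q_poch n ?m * inv_series (q_poch n (t_S * ?m)))) =
    (\<Prod>r<Suc M. 1 - q_S n ^ r * (1 * ?p)) * (\<Prod>r<M. 1 - q_S n ^ r * (1 * ?m)) *
      (q_poch n (q_S n ^ Suc M * ?p) * inv_series (q_poch n (q_S n ^ Suc M * (t_S * ?p))) *
      (q_poch n (q_S n ^ M * ?m) * inv_series (q_poch n (q_S n ^ M * (t_S * ?m)))))"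
    unfolding rearrange inv_series_q_poch_split[OF n p(2)] inv_series_q_poch_split[OF n m(2)]
      q_poch_split[OF n p(1), of "Suc M"] q_poch_split[OF n m(1), of M] mult_1_left
    by (simp only: mult_ac)
qed

lemma homogeneous_series_J_factor:
  assumes "homogeneous_series n x" "homogeneous_series n y" "fps_nth x 0 = 0" "fps_nth y 0 = 0"
  shows "homogeneous_series n (q_poch n x * inv_series (q_poch n y))"
  using assms
  by (intro homogeneous_series_mult homogeneous_series_inv_series homogeneous_series_q_poch[OF n]
      q_poch_nth_0[OF n])

lemma locally_finite_J_series: "locally_finite (J_series n t_S)"
  and locally_finite_q_tail: "locally_finite (q_tail M)"
proof -
  have p: "homogeneous_series n (pos_root n i j)" if "(i, j) \<in> pairs n" for i j
    using that by (intro homogeneous_series_pos_root) (auto simp: pairs_def)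
  have m: "homogeneous_series n (q_neg_root n i j)" if "(i, j) \<in> pairs n" for i j
    using that by (intro homogeneous_series_q_neg_root) (auto simp: pairs_def)
  have "homogeneous_series n (J_series n t_S)"
    unfolding J_series_def
    by (intro homogeneous_series_prod, clarify)
      (intro homogeneous_series_mult[OF homogeneous_series_J_factor homogeneous_series_J_factor] p m
        homogeneous_series_mult homogeneous_series_t_S;
       simp add: pos_root_nth_0 q_neg_root_nth_0)
  then show "locally_finite (J_series n t_S)" by (rule homogeneous_series_locally_finite)
  have "homogeneous_series n (q_tail M)"
    unfolding q_tail_def
    by (intro homogeneous_series_prod, clarify)
      (intro homogeneous_series_mult[OF homogeneous_series_J_factor homogeneous_series_J_factor] p m
        homogeneous_series_mult homogeneous_series_t_S homogeneous_series_power homogeneous_series_q_S[OF n];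
       simp add: pos_root_nth_0 q_neg_root_nth_0)
  then show "locally_finite (q_tail M)" by (rule homogeneous_series_locally_finite)
qed

lemma q_tail_cong: "fps_const (const [:0, 1:] ^ M) dvd q_tail M - 1"
proof -
  let ?c = "fps_const (const [:0, 1:] ^ M) :: graded_series"
  have "q_S n ^ M = ?c * (fps_X ^ n) ^ M"
    by (simp only: q_S_eq[OF n] power_mult_distrib fps_const_power mult.commute)
  then have M: "?c dvd q_S n ^ M * Z" for Z by simp
  have SM: "?c dvd q_S n ^ Suc M * Z" for Z
    using M[of "q_S n * Z"] by (simp add: mult_ac)
  show ?thesis
    unfolding q_tail_def
    by (intro dvd_prod_minus_one, clarify)
      (intro dvd_mult_minus_one dvd_inv_series_minus_one dvd_q_poch_minus_one[OF n] q_poch_nth_0[OF n] M SM;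
       simp add: pos_root_nth_0 q_neg_root_nth_0)
qed

section \<open>Reduction of both inner products to one series\<close>

lemma q_poch_shift:
  assumes z: "fps_nth z 0 = 0"
  shows "(1 - z) * inv_series (q_poch n z) = inv_series (q_poch n (q_S n * z))"
  using inv_series_q_poch_split[OF n z, of 1] by simp

text \<open>Passing from \<open>t\<close> to \<open>q t\<close> drops the first factor of each
  denominator: \<open>(t z; q) = (1 - t z) (q t z; q)\<close>.\<close>

lemma J_series_shift:
  "J_series n (q_S n * t_S) = (\<Prod>(i, j)\<in>pairs n. (1 - t_S * pos_root n i j) * (1 - t_S * q_neg_root n i j)) *
    J_series n t_S"
  unfolding J_series_def prod.distrib[symmetric]
proof (intro prod.cong refl, clarify)
  fix i j assume ij: "(i, j) \<in> pairs n"
  let ?p = "pos_root n i j" and ?m = "q_neg_root n i j"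
  have p: "fps_nth (t_S * ?p) 0 = 0" and m: "fps_nth (t_S * ?m) 0 = 0"
    by (simp_all add: pos_root_nth_0[OF ij] q_neg_root_nth_0[OF ij])
  show "q_poch n ?p * inv_series (q_poch n (q_S n * t_S * ?p)) *
      (q_poch n ?m * inv_series (q_poch n (q_S n * t_S * ?m))) =
    (1 - t_S * ?p) * (1 - t_S * ?m) *
      (q_poch n ?p * inv_series (q_poch n (t_S * ?p)) * (q_poch n ?m * inv_series (q_poch n (t_S * ?m))))"
    unfolding mult.assoc[of "q_S n" t_S] q_poch_shift[OF p, symmetric] q_poch_shift[OF m, symmetric]
    by (simp only: mult_ac)
qed

definition opposite_factor :: "ratfun_qs \<Rightarrow> ratfun_qs lpoly"
  where "opposite_factor s = (\<Prod>(i, j)\<in>pairs n. 1 - const s * root_monom j i)"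

lemma ungraded_J_series_shift:
  "ungraded (J_series n (q_S n * t_S)) =
    act (lead_factor n t_K * opposite_factor (q_K * t_K)) (ungraded (J_series n t_S))"
proof -
  have "represents (\<Prod>(i, j)\<in>pairs n. (1 - t_S * pos_root n i j) * (1 - t_S * q_neg_root n i j))
    (\<Prod>(i, j)\<in>pairs n. (1 - const t_K * root_monom i j) * (1 - const t_K * (const q_K * root_monom j i)))"
    unfolding case_prod_beta
    by (intro represents_prod represents_mult represents_diff represents_one represents_t_S
        represents_pos_root represents_q_neg_root) (auto simp: pairs_def)
  also have "(\<Prod>(i, j)\<in>pairs n. (1 - const t_K * root_monom i j) * (1 - const t_K * (const q_K * root_monom j i)))
    = lead_factor n t_K * opposite_factor (q_K * t_K)"
    unfolding lead_factor_def opposite_factor_def prod.distrib[symmetric]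
    by (intro prod.cong refl) (simp add: case_prod_beta const_mult mult_ac)
  finally show ?thesis
    using locally_finite_J_series by (simp add: J_series_shift represents_def)
qed

text \<open>The monomial \<open>x\<^sub>j\<close> taken out of a factor cancels against the one
  taken out of its image under \<open>bar\<close>.\<close>

lemma A_rho_mult_bar_A_rho: "A_rho n * bar (A_rho n) = lead_factor n t_K * opposite_factor (inverse t_K)"
  unfolding A_rho_def bar_prod lead_factor_def opposite_factor_def prod.distrib[symmetric]
proof (intro prod.cong refl, clarify)
  fix i j
  let ?u = "Poly_Mapping.single (- Poly_Mapping.single j 1) 1 :: ratfun_qs lpoly"
  have "var j - const t_K * var i = var j * (1 - const t_K * root_monom i j)"
    by (simp add: var_def const_def root_monom_def mult_single right_diff_distrib)
  moreover have "bar (var j - const t_K * var i) = ?u * (1 - const (inverse t_K) * root_monom j i)"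
    by (simp add: var_def const_def root_monom_def mult_single right_diff_distrib bar_diff bar_single
        bar_K_simps inj_homD(1)[OF inj_hom_bar_K])
  moreover have "var j * ?u = 1" by (simp add: var_def mult_single)
  moreover have "(a * x) * (b * y) = (a * b) * (x * y)" for a b x y :: "ratfun_qs lpoly"
    by (simp only: mult_ac)
  ultimately show "(var j - const t_K * var i) * bar (var j - const t_K * var i) =
    (1 - const t_K * root_monom i j) * (1 - const (inverse t_K) * root_monom j i)" by simp
qed

text \<open>The monomial turns the leading product of the factors
  \<open>1 - x\<^sub>i / x\<^sub>j\<close> into the Vandermonde product of the
  \<open>x\<^sub>j - x\<^sub>i\<close>, which is antisymmetric on the nose.\<close>

definition J_numerator :: "exponent \<Rightarrow> ratfun_s fls"
  where "J_numerator = act (\<Prod>(i, j)\<in>pairs n. var j) (act (lead_factor n t_K) (ungraded (J_series n t_S)))"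

lemma integral_lpoly_root_monom: "integral_lpoly (root_monom i j)"
  by (simp add: root_monom_def integral_lpoly_single_1)

text \<open>This is \<open>graded_factor_J_series\<close> at \<open>u = 1\<close>, with the tail
  replaced by 1 at the cost of a multiple of \<open>q ^ M\<close>.\<close>

lemma J_numerator_cong:
  "q_divisible M (\<lambda>\<mu>. act (symmetric_factor n t_K M) J_numerator \<mu> -
    act (symmetric_factor n 1 M * (\<Prod>(i, j)\<in>pairs n. var j - var i)) delta \<mu>)"
proof -
  let ?X = "(\<Prod>(i, j)\<in>pairs n. var j) :: ratfun_qs lpoly"
  let ?L = "lead_factor n t_K * symmetric_factor n t_K M" and ?N = "lead_factor n 1 * symmetric_factor n 1 M"
  have rep1: "represents 1 (const 1)" by (simp add: const_one represents_one)
  have "act ?L (ungraded (J_series n t_S)) = ungraded (graded_factor t_S M * J_series n t_S)"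
    using represents_graded_factor[OF represents_t_S, of M] locally_finite_J_series
    by (simp add: represents_def)
  also have "\<dots> = act ?N (ungraded (q_tail M))"
    unfolding graded_factor_J_series
    using represents_graded_factor[OF rep1, of M] locally_finite_q_tail by (simp add: represents_def)
  finally have L: "act ?L (ungraded (J_series n t_S)) = act ?N (ungraded (q_tail M))" .
  have "act (symmetric_factor n t_K M) J_numerator = act ?X (act ?L (ungraded (J_series n t_S)))"
    unfolding J_numerator_def act_mult[symmetric] by (simp only: mult_ac)
  also have "\<dots> = act (?X * ?N) (ungraded (q_tail M))" unfolding L by (rule act_mult[symmetric])
  finally have 1: "act (symmetric_factor n t_K M) J_numerator = act (?X * ?N) (ungraded (q_tail M))" .
  have XV: "?X * lead_factor n 1 = (\<Prod>(i, j)\<in>pairs n. var j - var i)"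
    unfolding lead_factor_def prod.distrib[symmetric]
    by (intro prod.cong refl)
      (simp add: case_prod_beta const_one right_diff_distrib var_def root_monom_def mult_single)
  have 2: "symmetric_factor n 1 M * (\<Prod>(i, j)\<in>pairs n. var j - var i) = ?X * ?N"
    unfolding XV[symmetric] by (simp only: mult_ac)
  have "integral_lpoly ?X"
    by (intro integral_lpoly_prod) (auto simp: var_def integral_lpoly_single_1)
  moreover have "integral_lpoly (lead_factor n 1)"
    unfolding lead_factor_def const_one
    by (intro integral_lpoly_prod) (auto intro!: integral_lpoly_diff integral_lpoly_one integral_lpoly_root_monom)
  moreover have "integral_lpoly (symmetric_factor n 1 M)"
    by (rule integral_lpoly_symmetric_factor[of _ 1]) simp
  ultimately have "integral_lpoly (?X * ?N)"
    by (intro integral_lpoly_mult)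
  then have "q_divisible (0 + M) (act (?X * ?N) (\<lambda>\<mu>. ungraded (q_tail M) \<mu> - delta \<mu>))"
    unfolding integral_lpoly_def
    by (rule q_divisible_act) (rule q_divisible_ungraded_minus_delta[OF q_tail_cong])
  then show ?thesis by (simp add: 1 2 act_fun_diff)
qed

lemma antisymmetric_J_numerator: "antisymmetric n J_numerator"
  unfolding antisymmetric_def
proof (intro allI impI)
  fix w \<mu> assume w: "w permutes {1..n}"
  let ?e = "(-1) ^ card (inversions n w) :: ratfun_qs"
  let ?V = "(\<Prod>(i, j)\<in>pairs n. var j - var i) :: ratfun_qs lpoly"
  have "integral_lpoly (\<Prod>(i, j)\<in>pairs n. var j)" "integral_lpoly (lead_factor n t_K)"
  proof -
    show "integral_lpoly (\<Prod>(i, j)\<in>pairs n. var j)"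
      by (intro integral_lpoly_prod) (auto simp: var_def integral_lpoly_single_1)
    have "integral_lpoly (const t_K)"
      by (simp add: integral_lpoly_def const_def q_divisible_def expand_q_t_K delta_def)
    then show "integral_lpoly (lead_factor n t_K)"
      unfolding lead_factor_def
      by (intro integral_lpoly_prod)
        (auto intro!: integral_lpoly_diff integral_lpoly_one integral_lpoly_mult integral_lpoly_root_monom)
  qed
  then have "q_divisible (0 + (0 + 0)) J_numerator"
    unfolding J_numerator_def integral_lpoly_def
    by (intro q_divisible_act q_divisible_ungraded)
  then have c0: "q_divisible 0 J_numerator" by simp
  have "permute_vars w ?V = (\<Prod>(i, j)\<in>pairs n. var (w j) - var (w i))"
    unfolding permute_vars_prod[OF w] case_prod_beta
    by (simp only: permute_vars_diff[OF w] permute_vars_var[OF w])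
  also have "\<dots> = (-1) ^ card (inversions n w) * ?V" by (rule vandermonde_permutes[OF w])
  also have "(-1) ^ card (inversions n w) = (const ?e :: ratfun_qs lpoly)"
    unfolding const_power by (simp add: const_def single_uminus)
  finally have V: "permute_vars w ?V = const ?e * ?V" .
  have "J_numerator (Poly_Mapping.map_key w \<mu>) = expand_q ?e * J_numerator \<mu>"
  proof (rule antisymmetric_of_congruences[OF w c0])
    show "q_divisible 0 (act (const ?e) delta)"
      using integral_lpoly_uminus_one_power by (simp add: integral_lpoly_def)
    fix m
    show "\<exists>D N. permute_vars w D = D \<and> permute_vars w N = const ?e * N \<and>
      q_divisible 1 (act (D - 1) delta) \<and> q_divisible m (\<lambda>\<mu>. act D J_numerator \<mu> - act N delta \<mu>)"
    proof (intro exI conjI)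
      show "permute_vars w (symmetric_factor n t_K m) = symmetric_factor n t_K m"
        by (rule permute_vars_symmetric_factor[OF w])
      show "permute_vars w (symmetric_factor n 1 m * ?V) = const ?e * (symmetric_factor n 1 m * ?V)"
        by (simp only: permute_vars_mult[OF w] permute_vars_symmetric_factor[OF w] V mult_ac)
      show "q_divisible 1 (act (symmetric_factor n t_K m - 1) delta)"
        by (rule q_divisible_symmetric_factor[OF expand_q_t_K])
    qed (rule J_numerator_cong)
  qed
  then show "J_numerator (Poly_Mapping.map_key w \<mu>) = of_int (sign w) * J_numerator \<mu>"
    by (simp add: sign_eq_inversions[OF w])
qed

lemma antisymmetric_act:
  assumes "antisymmetric n c" "\<And>w. w permutes {1..n} \<Longrightarrow> permute_vars w h = h"
  shows "antisymmetric n (act h c)"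
  unfolding antisymmetric_def
proof (intro allI impI)
  fix w \<mu> assume w: "w permutes {1..n}"
  have "act h c (Poly_Mapping.map_key w \<mu>) = act h (\<lambda>\<mu>. c (Poly_Mapping.map_key w \<mu>)) \<mu>"
    using act_permute_vars[OF w, of h c] assms(2)[OF w] by simp
  also have "(\<lambda>\<mu>. c (Poly_Mapping.map_key w \<mu>)) = (\<lambda>\<mu>. of_int (sign w) * c \<mu>)"
    using assms(1) w by (simp add: antisymmetric_def)
  finally show "act h c (Poly_Mapping.map_key w \<mu>) = of_int (sign w) * act h c \<mu>"
    by (simp only: act_fun_scale)
qed

text \<open>The point is that \<open>C\<close> does not depend on \<open>s\<close>: all of
  \<open>s\<close> sits in the factors \<open>x\<^sub>i - s x\<^sub>j\<close>, and the rest is one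
  antisymmetric coefficient function.\<close>

lemma constant_term_opposite_factor:
  assumes h: "\<And>w. w permutes {1..n} \<Longrightarrow> permute_vars w h = h"
  obtains C where "\<And>s. act (h * opposite_factor s) (act (lead_factor n t_K) (ungraded (J_series n t_S))) 0 =
    expand_q (W0 n s) * C"
proof -
  define v where "v i = (Poly_Mapping.single (- Poly_Mapping.single i 1) 1 :: ratfun_qs lpoly)" for i
  let ?X = "(\<Prod>(i, j)\<in>pairs n. var j) :: ratfun_qs lpoly"
  \<comment> \<open>Clearing denominators in \<open>1 - s x\<^sub>j / x\<^sub>i\<close> leaves
    \<open>1 / x\<^sub>i\<close>, written as \<open>1 / (x\<^sub>i x\<^sub>j)\<close> times
    \<open>x\<^sub>j\<close>. The first part is symmetric over all pairs and joins \<open>h\<close>;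
    the second is the monomial required by \<open>J_numerator\<close>.\<close>
  let ?Y = "\<Prod>(i, j)\<in>pairs n. v i * v j"
  define c where "c = act (h * ?Y) J_numerator"
  have "antisymmetric n c"
    unfolding c_def
  proof (rule antisymmetric_act[OF antisymmetric_J_numerator])
    fix w assume w: "w permutes {1..n}"
    have "permute_vars w (v i) = v (w i)" for i
    proof -
      have "Poly_Mapping.map_key (inv w) (Poly_Mapping.single i 1) = (Poly_Mapping.single (w i) 1 :: exponent)"
        using map_key_single[OF permutes_inj[OF permutes_inv[OF w]], of "w i"] permutes_inverses(2)[OF w] by simp
      then show ?thesis
        by (simp add: v_def permute_vars_single[OF w] map_key_exponent_simps[OF permutes_inv[OF w]])
    qed
    then have "permute_vars w ?Y = (\<Prod>(i, j)\<in>pairs n. v (w i) * v (w j))"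
      unfolding permute_vars_prod[OF w] case_prod_beta by (simp only: permute_vars_mult[OF w])
    also have "\<dots> = ?Y" by (rule prod_pairs_permutes[OF w]) (rule mult.commute)
    finally show "permute_vars w (h * ?Y) = h * ?Y" by (simp only: permute_vars_mult[OF w] h[OF w])
  qed
  have "act (h * opposite_factor s) (act (lead_factor n t_K) (ungraded (J_series n t_S))) 0 =
      expand_q (W0 n s) * c (staircase n)" for s
  proof -
    have "opposite_factor s = (\<Prod>(i, j)\<in>pairs n. var i - const s * var j) * (?Y * ?X)"
      unfolding opposite_factor_def prod.distrib[symmetric]
    proof (intro prod.cong refl, clarify)
      fix i j
      have inv: "v j * var j = 1" by (simp add: v_def var_def mult_single)
      have root: "(var i - const s * var j) * v i = 1 - const s * root_monom j i"
        by (simp add: v_def var_def const_def root_monom_def mult_single left_diff_distrib)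
      show "1 - const s * root_monom j i = (var i - const s * var j) * (v i * v j * var j)"
        by (simp only: mult.assoc[of "v i"] inv mult_1_right root)
    qed
    then have "act (h * opposite_factor s) (act (lead_factor n t_K) (ungraded (J_series n t_S))) =
        act (\<Prod>(i, j)\<in>pairs n. var i - const s * var j) c"
      unfolding c_def J_numerator_def act_mult[symmetric] by (simp only: mult_ac)
    then show ?thesis
      using act_twisted_vandermonde[OF \<open>antisymmetric n c\<close>] by simp
  qed
  then show ?thesis by (rule that)
qed

end

theorem proposition6p4:
  fixes n :: nat and f g :: "ratfun_qs lpoly"
  assumes "n \<ge> 1"
    and "f \<in> symmetric_laurent_polys n"
    and "g \<in> symmetric_laurent_polys n"
  shows "inner_q_qt n f g =
    expand_q (W0 n (q_K * t_K) / W0 n (inverse t_K)) *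
    inner_q_t n (A_rho n * f) (A_rho n * g)"
proof -
  let ?h = "f * bar g"
  let ?c = "act (lead_factor n t_K) (ungraded (J_series n t_S))"
  have "permute_vars w ?h = ?h" if w: "w permutes {1..n}" for w
    using assms(2,3) w
    by (simp add: symmetric_laurent_polys_def permute_vars_mult[OF w] permute_vars_bar[OF w])
  \<comment> \<open>One constant serves both \<open>s = q t\<close> and
    \<open>s = t\<^sup>-\<^sup>1\<close>, so the two inner products are in the ratio of the two
    values of \<open>W0\<close>.\<close>
  then obtain C where C: "act (?h * opposite_factor n s) ?c 0 = expand_q (W0 n s) * C" for s
    using constant_term_opposite_factor[OF assms(1)] by blast
  have 1: "inner_q_qt n f g = act (?h * opposite_factor n (q_K * t_K)) ?c 0"
    unfolding inner_q_qt_def inner_prod_eq_act ungraded_J_series_shift[OF assms(1)] act_mult[symmetric]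
    by (simp only: mult_ac)
  have 2: "inner_q_t n (A_rho n * f) (A_rho n * g) = act (?h * opposite_factor n (inverse t_K)) ?c 0"
  proof -
    have "A_rho n * f * bar (A_rho n * g) = ?h * (A_rho n * bar (A_rho n))"
      by (simp only: bar_mult mult_ac)
    also have "\<dots> = ?h * opposite_factor n (inverse t_K) * lead_factor n t_K"
      unfolding A_rho_mult_bar_A_rho[OF assms(1)] by (simp only: mult_ac)
    finally show ?thesis
      by (simp only: inner_q_t_def inner_prod_eq_act act_mult)
  qed
  have 3: "expand_q (W0 n (q_K * t_K)) =
      expand_q (W0 n (q_K * t_K) / W0 n (inverse t_K)) * expand_q (W0 n (inverse t_K))"
    using W0_inverse_t_K_nonzero by (simp flip: expand_q_hom(3))
  show ?thesis unfolding 1 2 C by (subst 3) (rule mult.assoc)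
qed

end
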